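(* Let $(I,J,K)$ be a reduced triple and let $\mathcal{V}$ be the corresponding variety of Wajsberg hoops, i.e. $\mathcal{V}=\mathsf{V}(\{\mathbf{S}_i:i\in I\}\cup\{\mathbf{S}_j^\omega:j\in J\})$ if $K=\emptyset$, and $\mathcal{V}=\mathsf{V}(\{\mathbf{S}_i:i\in I\}\cup\{\mathbf{S}^\omega\})$ if $K=\{0\}$. Let $t(x)$ be a term in one variable in the language $\{\cdot,\to,\top\}$. The following are equivalent: (i) $t(x)$ is a multiplicative conucleus on $\mathcal{V}$; (ii) there exist subsets $I_1,I_2$ of $I$ and $J_1,J_2$ of $J$ such that - $I_1\cup I_2=I$ and $I_1\cap I_2=\emptyset$, - $(J_1,J_2)\in\{(J,\emptyset),(\emptyset,J)\}$, - $\gcd(k,l)=1$ for all $k\in I_1\cup J_1$ and $l\in I_2\cup J_2$, and - $\mathbf{S}_i\vDash t(x)\approx x$ and $\mathbf{S}_j^\omega\vDash t(x)\approx x$ for all $i\in I_1$, $j\in J_1$, - $\mathbf{S}_i\vDash t(x)\approx x^i$ for all $i\in I_2$, - $\mathbf{S}_j^\omega\vDash t(x)\approx x\cdot((x^{j+1}\to x^{2(j+1)})\to x^{j+1})$ for all $j\in J_2$, - if $K=\{0\}$, then $\mathbf{S}^\omega\vDash t(x)\approx x$.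
   Context: A hoop is an algebra $\langle A,\cdot,\to,\top\rangle$ such that $\langle A,\cdot,\top\rangle$ is a commutative monoid and $x\to x=\top$, $x\cdot(x\to y)=y\cdot(y\to x)$, $x\to(y\to z)=(x\cdot y)\to z$; it is partially ordered by $x\le y$ iff $x\to y=\top$. A Wajsberg hoop is a hoop satisfying $(x\to y)\to y\approx(y\to x)\to x$. $\mathsf{V}(\mathcal{K})$ is the variety generated by $\mathcal{K}$. Powers: $a^0=\top$, $a^{n+1}=a^n\cdot a$. $\mathbb{N}=\{1,2,\dots\}$, $\mathbb{N}_0=\mathbb{N}\cup\{0\}$. A multiplicative conucleus on a hoop $\mathbf{A}$ is a map $\delta\colon A\to A$ that is an interior operator ($\delta(a)\le a$, $\delta$ monotone, $\delta\delta=\delta$) with $\delta(a\cdot b)=\delta(a)\cdot\delta(b)$ for all $a,b$. A term $t(x)$ is a multiplicative conucleus on a variety $\mathcal{V}$ if its interpretation $t^{\mathbf{A}}$ is a multiplicative conucleus on $\mathbf{A}$ for every $\mathbf{A}\in\mathcal{V}$. Wajsberg hoops used: - For $n\in\mathbb{N}$, $\mathbf{S}_n$ has universe $\{0,\frac1n,\dots,\frac{n-1}n,1\}$, with $x\cdot y=\max\{x+y-1,0\}$, $x\to y=\min\{y-x+1,1\}$, $\top=1$. - $\mathbf{S}^\omega=\langle\mathbb{N}_0,+,\to,0\rangle$ with $i\to j=\max\{j-i,0\}$ (so $+$ plays the role of $\cdot$ and $0$ of $\top$). - For $n\in\mathbb{N}$, $\mathbf{S}_n^\omega$ has universe the interval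 $[(0,0),(n,0)]$ of $\mathbb{Z}^2$ in the lexicographic order, with $x\cdot y=\neg(\neg x\oplus\neg y)$, $x\to y=\neg x\oplus y$, $\top=(n,0)$, where $x\oplus y=\min\{x+y,(n,0)\}$ and $\neg x=(n,0)-x$. A reduced triple is $(I,J,K)$ with $I,J$ finite subsets of $\mathbb{N}$ and $K\subseteq\{0\}$ such that: $I\cup J\cup K\ne\emptyset$; if $K=\{0\}$ then $J=\emptyset$; for all $i\in I$ and $i'\in(I\setminus\{i\})\cup J$, $i$ does not divide $i'$; for all $j\in J$ and $j'\in J\setminus\{j\}$, $j$ does not divide $j'$. *)

theory Defs
  imports Complex_Main "HOL-Algebra.Group" "HOL-Library.Product_Lexorder" "HOL-Library.Product_Plus"
begin

section \<open>Hoops and multiplicative conuclei\<close>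

record 'a hoop = "'a monoid" +
  imp :: "'a \<Rightarrow> 'a \<Rightarrow> 'a" (infixr \<open>\<leadsto>\<index>\<close> 65)

definition hoop_le :: "('a, 'b) hoop_scheme \<Rightarrow> 'a \<Rightarrow> 'a \<Rightarrow> bool" (infix \<open>\<preceq>\<index>\<close> 50) where
  "x \<preceq>\<^bsub>A\<^esub> y \<longleftrightarrow> x \<leadsto>\<^bsub>A\<^esub> y = \<one>\<^bsub>A\<^esub>"

locale hoop = comm_monoid A for A (structure) +
  assumes imp_closed: "\<lbrakk>x \<in> carrier A; y \<in> carrier A\<rbrakk> \<Longrightarrow> x \<leadsto> y \<in> carrier A"
    and imp_self: "x \<in> carrier A \<Longrightarrow> x \<leadsto> x = \<one>"
    and divisibility:
      "\<lbrakk>x \<in> carrier A; y \<in> carrier A\<rbrakk> \<Longrightarrow> x \<otimes> (x \<leadsto> y) = y \<otimes> (y \<leadsto> x)"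
    and imp_imp:
      "\<lbrakk>x \<in> carrier A; y \<in> carrier A; z \<in> carrier A\<rbrakk>
        \<Longrightarrow> x \<leadsto> (y \<leadsto> z) = (x \<otimes> y) \<leadsto> z"

locale multiplicative_conucleus = hoop A for A (structure) +
  fixes \<delta> :: "'a \<Rightarrow> 'a"
  assumes delta_closed: "a \<in> carrier A \<Longrightarrow> \<delta> a \<in> carrier A"
    and delta_decreasing: "a \<in> carrier A \<Longrightarrow> \<delta> a \<preceq> a"
    and delta_mono:
      "\<lbrakk>a \<in> carrier A; b \<in> carrier A; a \<preceq> b\<rbrakk> \<Longrightarrow> \<delta> a \<preceq> \<delta> b"
    and delta_idem: "a \<in> carrier A \<Longrightarrow> \<delta> (\<delta> a) = \<delta> a"
    and delta_mult:
      "\<lbrakk>a \<in> carrier A; b \<in> carrier A\<rbrakk> \<Longrightarrow> \<delta> (a \<otimes> b) = \<delta> a \<otimes> \<delta> b"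


section \<open>Terms, equations and equational classes\<close>

datatype (vars: 'v) hterm =
    Var 'v
  | Mult "'v hterm" "'v hterm" (infixl \<open>\<odot>\<close> 70)
  | Imp "'v hterm" "'v hterm" (infixr \<open>\<rightarrow>\<^sub>t\<close> 65)
  | Top

primrec tpow :: "'v hterm \<Rightarrow> nat \<Rightarrow> 'v hterm" where
  "tpow s 0 = Top"
| "tpow s (Suc n) = tpow s n \<odot> s"

primrec eval :: "('a, 'b) hoop_scheme \<Rightarrow> ('v \<Rightarrow> 'a) \<Rightarrow> 'v hterm \<Rightarrow> 'a" where
  "eval A v (Var x) = v x"
| "eval A v (s \<odot> t) = eval A v s \<otimes>\<^bsub>A\<^esub> eval A v t"
| "eval A v (s \<rightarrow>\<^sub>t t) = eval A v s \<leadsto>\<^bsub>A\<^esub> eval A v t"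
| "eval A v Top = \<one>\<^bsub>A\<^esub>"

definition satisfies_eq ::
    "('a, 'b) hoop_scheme \<Rightarrow> 'v hterm \<Rightarrow> 'v hterm \<Rightarrow> bool"
    (\<open>(_ \<Turnstile> _ \<approx> _)\<close> [51, 51, 51] 50) where
  "A \<Turnstile> s \<approx> t \<longleftrightarrow> (\<forall>v. (\<forall>x. v x \<in> carrier A) \<longrightarrow> eval A v s = eval A v t)"

type_synonym equation = "nat hterm \<times> nat hterm"

definition satisfies_all :: "('a, 'b) hoop_scheme \<Rightarrow> equation set \<Rightarrow> bool" where
  "satisfies_all A E \<longleftrightarrow> (\<forall>(s, t)\<in>E. A \<Turnstile> s \<approx> t)"

text \<open>Algebras of the signature of hoops, with no equations imposed.\<close>

definition is_algebra :: "('a, 'b) hoop_scheme \<Rightarrow> bool" where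
  "is_algebra A \<longleftrightarrow> \<one>\<^bsub>A\<^esub> \<in> carrier A \<and>
     (\<forall>x\<in>carrier A. \<forall>y\<in>carrier A. x \<otimes>\<^bsub>A\<^esub> y \<in> carrier A \<and> x \<leadsto>\<^bsub>A\<^esub> y \<in> carrier A)"

definition equational_class :: "equation set \<Rightarrow> 'a hoop set" where
  "equational_class E = {A. is_algebra A \<and> satisfies_all A E}"

definition conucleus_term_on :: "'a hoop set \<Rightarrow> nat hterm \<Rightarrow> bool" where
  "conucleus_term_on V t \<longleftrightarrow>
     (\<forall>A\<in>V. multiplicative_conucleus A (\<lambda>a. eval A (\<lambda>_. a) t))"


section \<open>The generating Wajsberg hoops\<close>

definition Sn :: "nat \<Rightarrow> real hoop" where
  "Sn n = \<lparr>carrier = {real k / real n |k. k \<le> n},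
           monoid.mult = (\<lambda>x y. max (x + y - 1) 0),
           one = 1,
           imp = (\<lambda>x y. min (y - x + 1) 1)\<rparr>"

text \<open>Subtraction on the natural numbers is truncated, so \<open>j - i\<close> is \<open>max (j - i) 0\<close>.\<close>

definition S_omega :: "nat hoop" where
  "S_omega = \<lparr>carrier = UNIV,
              monoid.mult = (\<lambda>i j. i + j),
              one = 0,
              imp = (\<lambda>i j. j - i)\<rparr>"

text \<open>The order on pairs is lexicographic, and their addition is componentwise.\<close>

definition mv_neg :: "nat \<Rightarrow> int \<times> int \<Rightarrow> int \<times> int" where
  "mv_neg n x = (int n, 0) - x"

definition mv_plus :: "nat \<Rightarrow> int \<times> int \<Rightarrow> int \<times> int \<Rightarrow> int \<times> int" where
  "mv_plus n x y = min (x + y) (int n, 0)"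

definition Sn_omega :: "nat \<Rightarrow> (int \<times> int) hoop" where
  "Sn_omega n = \<lparr>carrier = {(0, 0)..(int n, 0)},
                 monoid.mult = (\<lambda>x y. mv_neg n (mv_plus n (mv_neg n x) (mv_neg n y))),
                 one = (int n, 0),
                 imp = (\<lambda>x y. mv_plus n (mv_neg n x) y)\<rparr>"


section \<open>Reduced triples and their varieties\<close>

definition reduced_triple :: "nat set \<Rightarrow> nat set \<Rightarrow> nat set \<Rightarrow> bool" where
  "reduced_triple I J K \<longleftrightarrow>
     finite I \<and> I \<subseteq> {1..} \<and> finite J \<and> J \<subseteq> {1..} \<and> K \<subseteq> {0} \<and>
     I \<union> J \<union> K \<noteq> {} \<and>
     (K = {0} \<longrightarrow> J = {}) \<and>
     (\<forall>i\<in>I. \<forall>i'\<in>(I - {i}) \<union> J. \<not> i dvd i') \<and>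
     (\<forall>j\<in>J. \<forall>j'\<in>J - {j}. \<not> j dvd j')"

definition generators_satisfy ::
    "nat set \<Rightarrow> nat set \<Rightarrow> nat set \<Rightarrow> equation set \<Rightarrow> bool" where
  "generators_satisfy I J K E \<longleftrightarrow>
     (\<forall>i\<in>I. satisfies_all (Sn i) E) \<and>
     (if K = {} then \<forall>j\<in>J. satisfies_all (Sn_omega j) E else satisfies_all S_omega E)"

text \<open>
  A variety is a class of algebras axiomatised by equations, and the variety generated by
  a class is the least one containing it. The generators live on different types, so they
  enter through the sets of equations they satisfy rather than as elements of one set.
  The type \<open>'a\<close> is the universe from which the members of the variety take their elements.
\<close>

definition variety_of :: "nat set \<Rightarrow> nat set \<Rightarrow> nat set \<Rightarrow> 'a hoop set" where
  "variety_of I J K = \<Inter> {equational_class E |E. generators_satisfy I J K E}"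

end

theory Submission
  imports Defs "HOL-Library.Countable_Set"
begin

text \<open>
  Being a multiplicative conucleus is an equational property of a term, so it holds on the
  variety iff it holds on the generators. On the chain \<open>S\<^sub>n\<close> every element is a power
  of \<open>c = 1 - 1/n\<close>, so a conucleus \<open>\<delta>\<close> is determined by \<open>\<delta> c = c\<^sup>k\<close>; idempotence leaves
  only \<open>k = 1\<close> (the identity) and \<open>k = n\<close> (everything below the top collapses to \<open>0\<close>, which is
  \<open>x\<^sup>n\<close>). On the negative cone of the integers only the identity is possible. The chain with
  radical contains both as subalgebras, the negative cone as the elements infinitely close to the
  top; there a conucleus term is the identity or collapses everything outside the radical, and the
  latter map is the term with implications. Common subalgebras make the choices on different
  generators compatible: \<open>S\<^sub>d\<close> with \<open>d = gcd k l\<close> for a pair of finite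
  chains, and the chain with radical for \<open>n = 1\<close> for a pair of chains with radical.
\<close>

section \<open>Conucleus terms and equations\<close>

primrec subst :: "('v \<Rightarrow> 'w hterm) \<Rightarrow> 'v hterm \<Rightarrow> 'w hterm" where
  "subst \<sigma> (Var x) = \<sigma> x"
| "subst \<sigma> (s \<odot> t) = subst \<sigma> s \<odot> subst \<sigma> t"
| "subst \<sigma> (s \<rightarrow>\<^sub>t t) = subst \<sigma> s \<rightarrow>\<^sub>t subst \<sigma> t"
| "subst \<sigma> Top = Top"

lemma eval_subst: "eval A v (subst \<sigma> t) = eval A (\<lambda>x. eval A v (\<sigma> x)) t"
  by (induction t) auto

lemma eval_cong: "(\<And>x. x \<in> vars t \<Longrightarrow> v x = w x) \<Longrightarrow> eval A v t = eval A w t"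
  by (induction t) auto

lemma eval_closed:
  "is_algebra A \<Longrightarrow> (\<And>x. v x \<in> carrier A) \<Longrightarrow> eval A v t \<in> carrier A"
  by (induction t) (auto simp: is_algebra_def)

lemma eval_unary: "vars t \<subseteq> {0} \<Longrightarrow> eval A v t = eval A (\<lambda>_. v 0) t"
  by (rule eval_cong) auto

lemma satisfies_unary_iff:
  fixes s t :: "nat hterm"
  assumes "vars s \<subseteq> {0}" "vars t \<subseteq> {0}"
  shows "A \<Turnstile> s \<approx> t \<longleftrightarrow> (\<forall>a\<in>carrier A. eval A (\<lambda>_. a) s = eval A (\<lambda>_. a) t)"
  unfolding satisfies_eq_def
  using eval_unary[OF assms(1), of A] eval_unary[OF assms(2), of A] by metis

lemma vars_tpow: "vars (tpow s n) \<subseteq> vars s"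
  by (induction n) auto

lemma hoop_is_algebra: "hoop A \<Longrightarrow> is_algebra A"
  unfolding is_algebra_def
  by (simp add: hoop.imp_closed hoop.axioms(1) comm_monoid.axioms(1) monoid.m_closed monoid.one_closed)

text \<open>Monotonicity is a quasi-equation; since \<open>a \<otimes> (a \<leadsto> b)\<close> is the meet of
  \<open>a\<close> and \<open>b\<close>, the last equation expresses it.\<close>

definition conucleus_equations :: "nat hterm \<Rightarrow> equation set" where
  "conucleus_equations t =
    {(Var 0 \<odot> Var 1 \<odot> Var 2, Var 0 \<odot> (Var 1 \<odot> Var 2)),
     (Var 0 \<odot> Var 1, Var 1 \<odot> Var 0),
     (Top \<odot> Var 0, Var 0),
     (Var 0 \<rightarrow>\<^sub>t Var 0, Top),
     (Var 0 \<odot> (Var 0 \<rightarrow>\<^sub>t Var 1), Var 1 \<odot> (Var 1 \<rightarrow>\<^sub>t Var 0)),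
     (Var 0 \<rightarrow>\<^sub>t (Var 1 \<rightarrow>\<^sub>t Var 2), Var 0 \<odot> Var 1 \<rightarrow>\<^sub>t Var 2),
     (subst (\<lambda>_. Var 0) t \<rightarrow>\<^sub>t Var 0, Top),
     (subst (\<lambda>_. subst (\<lambda>_. Var 0) t) t, subst (\<lambda>_. Var 0) t),
     (subst (\<lambda>_. Var 0 \<odot> Var 1) t, subst (\<lambda>_. Var 0) t \<odot> subst (\<lambda>_. Var 1) t),
     (subst (\<lambda>_. Var 0 \<odot> (Var 0 \<rightarrow>\<^sub>t Var 1)) t \<rightarrow>\<^sub>t subst (\<lambda>_. Var 1) t, Top)}"

lemma (in hoop) meet_le:
  assumes "a \<in> carrier A" "b \<in> carrier A"
  shows "a \<otimes> (a \<leadsto> b) \<preceq> b"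
  using assms by (simp add: hoop_le_def m_comm[of a] imp_imp[symmetric] imp_closed imp_self)

lemma (in multiplicative_conucleus) mono_meet:
  assumes "a \<in> carrier A" "b \<in> carrier A"
  shows "\<delta> (a \<otimes> (a \<leadsto> b)) \<leadsto> \<delta> b = \<one>"
  using delta_mono[OF _ _ meet_le[OF assms]] assms by (simp add: hoop_le_def imp_closed)

text \<open>With closure supplied by \<open>is_algebra\<close>, only monotonicity is not already an
  equation. If \<open>a \<preceq> b\<close> then \<open>a \<otimes> (a \<leadsto> b) = a\<close>, so
  the meet equation yields it; conversely the meet lies below \<open>b\<close>.\<close>

lemma satisfies_conucleus_equations_iff:
  assumes alg: "is_algebra A"
  shows "satisfies_all A (conucleus_equations t) \<longleftrightarrow>
    multiplicative_conucleus A (\<lambda>a. eval A (\<lambda>_. a) t)" (is "?L \<longleftrightarrow> ?R")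
proof
  assume L: ?L
  \<comment> \<open>Variables above 2 also take the value \<open>c\<close>, which keeps the whole
    valuation inside the carrier.\<close>
  define val where "val a b c = (\<lambda>n::nat. if n = 0 then a else if n = 1 then b else c)"
    for a b c :: 'a
  have val: "val a b c 0 = a" "val a b c 1 = b" "val a b c (Suc 0) = b" "val a b c 2 = c" for a b c
    by (auto simp: val_def)
  have eqs:
    "a \<otimes>\<^bsub>A\<^esub> b \<otimes>\<^bsub>A\<^esub> c = a \<otimes>\<^bsub>A\<^esub> (b \<otimes>\<^bsub>A\<^esub> c)"
    "a \<otimes>\<^bsub>A\<^esub> b = b \<otimes>\<^bsub>A\<^esub> a"
    "\<one>\<^bsub>A\<^esub> \<otimes>\<^bsub>A\<^esub> a = a"
    "a \<leadsto>\<^bsub>A\<^esub> a = \<one>\<^bsub>A\<^esub>"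
    "a \<otimes>\<^bsub>A\<^esub> (a \<leadsto>\<^bsub>A\<^esub> b) = b \<otimes>\<^bsub>A\<^esub> (b \<leadsto>\<^bsub>A\<^esub> a)"
    "a \<leadsto>\<^bsub>A\<^esub> (b \<leadsto>\<^bsub>A\<^esub> c) = (a \<otimes>\<^bsub>A\<^esub> b) \<leadsto>\<^bsub>A\<^esub> c"
    "eval A (\<lambda>_. a) t \<leadsto>\<^bsub>A\<^esub> a = \<one>\<^bsub>A\<^esub>"
    "eval A (\<lambda>_. eval A (\<lambda>_. a) t) t = eval A (\<lambda>_. a) t"
    "eval A (\<lambda>_. a \<otimes>\<^bsub>A\<^esub> b) t = eval A (\<lambda>_. a) t \<otimes>\<^bsub>A\<^esub> eval A (\<lambda>_. b) t"
    "eval A (\<lambda>_. a \<otimes>\<^bsub>A\<^esub> (a \<leadsto>\<^bsub>A\<^esub> b)) t \<leadsto>\<^bsub>A\<^esub> eval A (\<lambda>_. b) t = \<one>\<^bsub>A\<^esub>"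
    if "a \<in> carrier A" "b \<in> carrier A" "c \<in> carrier A" for a b c
  proof -
    have "\<forall>x. val a b c x \<in> carrier A"
      using that by (simp add: val_def)
    then have "\<forall>(s, s')\<in>conucleus_equations t. eval A (val a b c) s = eval A (val a b c) s'"
      using L by (simp add: satisfies_all_def satisfies_eq_def split_beta)
    note * = this[unfolded conucleus_equations_def ball_simps prod.case eval.simps eval_subst val]
    show
      "a \<otimes>\<^bsub>A\<^esub> b \<otimes>\<^bsub>A\<^esub> c = a \<otimes>\<^bsub>A\<^esub> (b \<otimes>\<^bsub>A\<^esub> c)"
      "a \<otimes>\<^bsub>A\<^esub> b = b \<otimes>\<^bsub>A\<^esub> a"
      "\<one>\<^bsub>A\<^esub> \<otimes>\<^bsub>A\<^esub> a = a"
      "a \<leadsto>\<^bsub>A\<^esub> a = \<one>\<^bsub>A\<^esub>"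
      "a \<otimes>\<^bsub>A\<^esub> (a \<leadsto>\<^bsub>A\<^esub> b) = b \<otimes>\<^bsub>A\<^esub> (b \<leadsto>\<^bsub>A\<^esub> a)"
      "a \<leadsto>\<^bsub>A\<^esub> (b \<leadsto>\<^bsub>A\<^esub> c) = (a \<otimes>\<^bsub>A\<^esub> b) \<leadsto>\<^bsub>A\<^esub> c"
      "eval A (\<lambda>_. a) t \<leadsto>\<^bsub>A\<^esub> a = \<one>\<^bsub>A\<^esub>"
      "eval A (\<lambda>_. eval A (\<lambda>_. a) t) t = eval A (\<lambda>_. a) t"
      "eval A (\<lambda>_. a \<otimes>\<^bsub>A\<^esub> b) t = eval A (\<lambda>_. a) t \<otimes>\<^bsub>A\<^esub> eval A (\<lambda>_. b) t"
      "eval A (\<lambda>_. a \<otimes>\<^bsub>A\<^esub> (a \<leadsto>\<^bsub>A\<^esub> b)) t \<leadsto>\<^bsub>A\<^esub> eval A (\<lambda>_. b) t = \<one>\<^bsub>A\<^esub>"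
      using * by - (elim conjE, assumption)+
  qed
  have one: "\<one>\<^bsub>A\<^esub> \<in> carrier A"
    using alg by (simp add: is_algebra_def)
  interpret hoop A
  proof unfold_locales
    fix x y z assume xyz: "x \<in> carrier A" "y \<in> carrier A" "z \<in> carrier A"
    show "x \<otimes>\<^bsub>A\<^esub> y \<otimes>\<^bsub>A\<^esub> z = x \<otimes>\<^bsub>A\<^esub> (y \<otimes>\<^bsub>A\<^esub> z)"
      "x \<leadsto>\<^bsub>A\<^esub> (y \<leadsto>\<^bsub>A\<^esub> z) = (x \<otimes>\<^bsub>A\<^esub> y) \<leadsto>\<^bsub>A\<^esub> z"
      by (rule eqs[OF xyz])+
  next
    fix x y assume xy: "x \<in> carrier A" "y \<in> carrier A"
    show "x \<otimes>\<^bsub>A\<^esub> y = y \<otimes>\<^bsub>A\<^esub> x"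
      "x \<otimes>\<^bsub>A\<^esub> (x \<leadsto>\<^bsub>A\<^esub> y) = y \<otimes>\<^bsub>A\<^esub> (y \<leadsto>\<^bsub>A\<^esub> x)"
      by (rule eqs[OF xy one])+
    show "x \<otimes>\<^bsub>A\<^esub> y \<in> carrier A" "x \<leadsto>\<^bsub>A\<^esub> y \<in> carrier A"
      using alg xy by (simp_all add: is_algebra_def)
  next
    fix x assume x: "x \<in> carrier A"
    show "x \<leadsto>\<^bsub>A\<^esub> x = \<one>\<^bsub>A\<^esub>" and *: "\<one>\<^bsub>A\<^esub> \<otimes>\<^bsub>A\<^esub> x = x"
      by (rule eqs[OF x one one])+
    show "x \<otimes>\<^bsub>A\<^esub> \<one>\<^bsub>A\<^esub> = x"
      using eqs(2)[OF x one one] * by simp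
  qed (rule one)
  show ?R
  proof
    fix a b assume ab: "a \<in> carrier A" "b \<in> carrier A"
    show "eval A (\<lambda>_. a) t \<preceq>\<^bsub>A\<^esub> eval A (\<lambda>_. b) t" if "a \<preceq>\<^bsub>A\<^esub> b"
    proof -
      have "a \<otimes>\<^bsub>A\<^esub> (a \<leadsto>\<^bsub>A\<^esub> b) = a"
        using ab r_one \<open>a \<preceq>\<^bsub>A\<^esub> b\<close> by (simp only: hoop_le_def)
      then show ?thesis
        using eqs(10)[OF ab ab(1)] by (simp only: hoop_le_def)
    qed
    show "eval A (\<lambda>_. a \<otimes>\<^bsub>A\<^esub> b) t = eval A (\<lambda>_. a) t \<otimes>\<^bsub>A\<^esub> eval A (\<lambda>_. b) t"
      by (rule eqs(9)[OF ab ab(1)])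
  next
    fix a assume a: "a \<in> carrier A"
    show "eval A (\<lambda>_. a) t \<in> carrier A"
      by (rule eval_closed[OF alg]) (rule a)
    show "eval A (\<lambda>_. a) t \<preceq>\<^bsub>A\<^esub> a"
      unfolding hoop_le_def by (rule eqs(7)[OF a a a])
    show "eval A (\<lambda>_. eval A (\<lambda>_. a) t) t = eval A (\<lambda>_. a) t"
      by (rule eqs(8)[OF a a a])
  qed
next
  assume ?R
  then interpret multiplicative_conucleus A "\<lambda>a. eval A (\<lambda>_. a) t" .
  show ?L
    unfolding conucleus_equations_def satisfies_all_def satisfies_eq_def ball_simps prod.case
      eval.simps eval_subst
    by (intro conjI allI impI TrueI;
        rule m_assoc m_comm l_one imp_self divisibility imp_imp delta_decreasing[unfolded hoop_le_def]
          delta_idem delta_mult mono_meet; simp)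
qed


section \<open>Embeddings\<close>

locale hoop_embedding =
  fixes A :: "('a, 'c) hoop_scheme" and B :: "('b, 'd) hoop_scheme" and h :: "'a \<Rightarrow> 'b"
  assumes algebra: "is_algebra A"
    and inj: "inj_on h (carrier A)"
    and closed: "x \<in> carrier A \<Longrightarrow> h x \<in> carrier B"
    and hom_mult: "\<lbrakk>x \<in> carrier A; y \<in> carrier A\<rbrakk> \<Longrightarrow> h (x \<otimes>\<^bsub>A\<^esub> y) = h x \<otimes>\<^bsub>B\<^esub> h y"
    and hom_imp: "\<lbrakk>x \<in> carrier A; y \<in> carrier A\<rbrakk> \<Longrightarrow> h (x \<leadsto>\<^bsub>A\<^esub> y) = h x \<leadsto>\<^bsub>B\<^esub> h y"
    and hom_one: "h \<one>\<^bsub>A\<^esub> = \<one>\<^bsub>B\<^esub>"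
begin

lemma hom_eval: "(\<And>x. v x \<in> carrier A) \<Longrightarrow> h (eval A v t) = eval B (\<lambda>x. h (v x)) t"
  by (induction t) (auto simp: hom_mult hom_imp hom_one eval_closed algebra)

lemma satisfies_eq_reflect:
  fixes s t :: "'v hterm"
  assumes "B \<Turnstile> s \<approx> t"
  shows "A \<Turnstile> s \<approx> t"
  unfolding satisfies_eq_def
proof (intro allI impI)
  fix v :: "'v \<Rightarrow> 'a" assume v: "\<forall>x. v x \<in> carrier A"
  then have "h (eval A v s) = h (eval A v t)"
    using assms by (simp add: satisfies_eq_def hom_eval closed)
  then show "eval A v s = eval A v t"
    using v inj by (simp add: inj_on_eq_iff eval_closed algebra)
qed

lemma satisfies_all_reflect: "satisfies_all B E \<Longrightarrow> satisfies_all A E"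
  unfolding satisfies_all_def split_beta by (intro ballI satisfies_eq_reflect) (erule bspec)

text \<open>The hoop laws and the conucleus clauses together are the equations
  \<open>conucleus_equations t\<close>, and equations pass down to subalgebras.\<close>

lemma conucleus_reflect:
  fixes t :: "nat hterm"
  assumes "multiplicative_conucleus B (\<lambda>a. eval B (\<lambda>_. a) t)"
  shows "multiplicative_conucleus A (\<lambda>a. eval A (\<lambda>_. a) t)"
proof -
  have "is_algebra B"
    using assms by (intro hoop_is_algebra multiplicative_conucleus.axioms(1))
  then have "satisfies_all B (conucleus_equations t)"
    using assms by (simp only: satisfies_conucleus_equations_iff)
  then show ?thesis
    using satisfies_all_reflect satisfies_conucleus_equations_iff[OF algebra] by blast
qed

end

section \<open>Isomorphic copies on another type\<close>

text \<open>Transport of structure along \<open>f\<close>, meaningful when \<open>f\<close> is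
  injective on the carrier.\<close>

definition hoop_copy :: "('a \<Rightarrow> 'b) \<Rightarrow> 'a hoop \<Rightarrow> 'b hoop" where
  "hoop_copy f A = \<lparr>carrier = f ` carrier A,
     monoid.mult = (\<lambda>x y. f (inv_into (carrier A) f x \<otimes>\<^bsub>A\<^esub> inv_into (carrier A) f y)),
     one = f \<one>\<^bsub>A\<^esub>,
     imp = (\<lambda>x y. f (inv_into (carrier A) f x \<leadsto>\<^bsub>A\<^esub> inv_into (carrier A) f y))\<rparr>"

lemma hoop_embedding_copy:
  assumes "is_algebra A" "inj_on f (carrier A)"
  shows "hoop_embedding A (hoop_copy f A) f"
  using assms by unfold_locales (auto simp: hoop_copy_def)

lemma hoop_embedding_copy_inv:
  assumes "is_algebra A" "inj_on f (carrier A)"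
  shows "hoop_embedding (hoop_copy f A) A (inv_into (carrier A) f)"
proof unfold_locales
  show "is_algebra (hoop_copy f A)"
    using assms by (auto simp: is_algebra_def hoop_copy_def)
qed (use assms in \<open>auto simp: is_algebra_def hoop_copy_def inj_on_inv_into\<close>)

text \<open>The generators live on other types than the members of the variety, but they are
  countable, so each has an isomorphic copy on the infinite type \<open>'a\<close>.\<close>

lemma conucleus_generator:
  fixes A :: "'b hoop" and t :: "nat hterm"
  assumes inf: "infinite (UNIV :: 'a set)"
    and con: "conucleus_term_on (variety_of I J K :: 'a hoop set) t"
    and alg: "is_algebra A" and count: "countable (carrier A)"
    and gen: "\<And>E. generators_satisfy I J K E \<Longrightarrow> satisfies_all A E"
  shows "satisfies_all A (conucleus_equations t)"
proof -
  obtain g :: "nat \<Rightarrow> 'a" where g: "inj g"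
    using infinite_countable_subset[OF inf] by blast
  define f where "f = g \<circ> to_nat_on (carrier A)"
  have f: "inj_on f (carrier A)"
    unfolding f_def using count g by (intro comp_inj_on) (auto intro: inj_on_subset)
  interpret f: hoop_embedding A "hoop_copy f A" f
    by (rule hoop_embedding_copy[OF alg f])
  interpret f': hoop_embedding "hoop_copy f A" A "inv_into (carrier A) f"
    by (rule hoop_embedding_copy_inv[OF alg f])
  \<comment> \<open>Both directions of the isomorphism serve: \<open>f'\<close> carries the
    equations of \<open>A\<close> to the copy, which puts the copy into the variety;
    \<open>f\<close> then brings the conucleus equations back to \<open>A\<close>.\<close>
  have "hoop_copy f A \<in> equational_class E" if "generators_satisfy I J K E" for E
    using f'.satisfies_all_reflect[OF gen[OF that]] f'.algebra by (simp add: equational_class_def)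
  then have "hoop_copy f A \<in> variety_of I J K"
    unfolding variety_of_def by blast
  then have "multiplicative_conucleus (hoop_copy f A) (\<lambda>a. eval (hoop_copy f A) (\<lambda>_. a) t)"
    using con by (simp add: conucleus_term_on_def)
  then show ?thesis
    by (simp add: f.satisfies_all_reflect satisfies_conucleus_equations_iff f'.algebra)
qed


section \<open>Hoops on intervals of linearly ordered groups\<close>

text \<open>The lexicographic order is translation invariant, so the interval locale covers
  \<open>int \<times> int\<close> as well as the reals.\<close>

instance prod :: (linordered_ab_group_add, linordered_ab_group_add) linordered_ab_group_add
  by standard (auto simp: less_eq_prod_def)

text \<open>The hoop operations of Mundici's MV-algebra on the interval from \<open>0\<close> to
  \<open>u\<close>. The carrier may be a proper part of the interval, as it is for
  \<open>Sn n\<close> inside the reals.\<close>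

locale interval_hoop =
  fixes A :: "'a::linordered_ab_group_add hoop" (structure) and u :: 'a
  assumes carrier_subset: "carrier A \<subseteq> {0..u}"
    and algebra: "is_algebra A"
    and mult_eq: "x \<otimes> y = max (x + y - u) 0"
    and imp_eq: "x \<leadsto> y = min (y - x + u) u"
    and one_eq: "\<one> = u"
begin

lemma bounds: "x \<in> carrier A \<Longrightarrow> 0 \<le> x" "x \<in> carrier A \<Longrightarrow> x \<le> u"
  using carrier_subset by auto

lemma le_iff: "x \<preceq> y \<longleftrightarrow> x \<le> y"
proof -
  have "x \<preceq> y \<longleftrightarrow> u \<le> y - x + u"
    by (auto simp: hoop_le_def imp_eq one_eq min_def)
  then show ?thesis by simp
qed

lemma meet_eq:
  assumes "x \<in> carrier A" "y \<in> carrier A"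
  shows "x \<otimes> (x \<leadsto> y) = min x y"
proof -
  have "x + min (y - x + u) u - u = min y x"
    by (simp add: min_def algebra_simps)
  then show ?thesis
    using bounds[OF assms(1)] bounds[OF assms(2)]
    by (simp add: mult_eq imp_eq min.commute max_absorb1)
qed

text \<open>The inner truncation disappears because \<open>z \<le> u\<close>. What remains is
  symmetric in the three factors, whence associativity.\<close>

lemma mult_assoc:
  assumes "z \<in> carrier A"
  shows "x \<otimes> y \<otimes> z = max (x + y + z - u - u) 0"
proof -
  have "max (x + y - u) 0 + z - u = max (x + y + z - u - u) (z - u)"
    by (simp add: max_def algebra_simps)
  then show ?thesis
    using bounds[OF assms] by (simp add: mult_eq max.assoc max_absorb2)
qed

sublocale hoop A
proof unfold_locales
  fix x y z assume xyz: "x \<in> carrier A" "y \<in> carrier A" "z \<in> carrier A"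
  have "x \<otimes> (y \<otimes> z) = y \<otimes> z \<otimes> x" by (simp add: mult_eq algebra_simps)
  then show "x \<otimes> y \<otimes> z = x \<otimes> (y \<otimes> z)"
    using xyz by (simp add: mult_assoc algebra_simps)
  \<comment> \<open>Subtraction turns the truncating \<open>max\<close> into a \<open>min\<close>.
    Two arguments are then absorbed by the outer minimum with \<open>u\<close>:
    \<open>u - x + u\<close> because \<open>x \<le> u\<close>, and \<open>z + u\<close> because
    \<open>0 \<le> z\<close>.\<close>
  have sub_max: "z - max a 0 + u = min (z - a + u) (z + u)" for a
    by (cases "a \<le> 0") (auto simp: max_def min_def)
  have "x \<leadsto> (y \<leadsto> z) = min (min (z - y - x + u + u) (u - x + u)) u"
    by (simp add: imp_eq min_def algebra_simps)
  also have "\<dots> = min (z - y - x + u + u) u"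
    using bounds[OF xyz(1)] by (simp add: min.assoc min_absorb2)
  also have "\<dots> = min (min (z - y - x + u + u) (z + u)) u"
    using bounds[OF xyz(3)] by (simp add: min.assoc min_absorb2)
  also have "\<dots> = (x \<otimes> y) \<leadsto> z"
    by (simp only: imp_eq mult_eq sub_max) (simp add: algebra_simps)
  finally show "x \<leadsto> (y \<leadsto> z) = (x \<otimes> y) \<leadsto> z" .
next
  fix x y assume "x \<in> carrier A" "y \<in> carrier A"
  then show "x \<otimes> (x \<leadsto> y) = y \<otimes> (y \<leadsto> x)"
    by (simp add: meet_eq min.commute)
  show "x \<otimes> y = y \<otimes> x"
    by (simp add: mult_eq add.commute)
next
  fix x assume "x \<in> carrier A"
  then have "0 \<le> x"
    by (rule bounds)
  then show "\<one> \<otimes> x = x" "x \<otimes> \<one> = x" "x \<leadsto> x = \<one>"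
    by (simp_all add: mult_eq imp_eq one_eq max_absorb1)
qed (use algebra in \<open>simp_all add: is_algebra_def\<close>)

text \<open>\<open>F\<close> acts as a filter: being closed upwards and under products, it contains
  a product of carrier elements exactly when it contains both factors. It will be the top element
  alone or the radical.\<close>

lemma conucleus_collapse:
  assumes zero: "0 \<in> carrier A"
    and one: "u \<in> F"
    and up: "\<And>x y. \<lbrakk>x \<in> F; x \<le> y; y \<in> carrier A\<rbrakk> \<Longrightarrow> y \<in> F"
    and mult: "\<And>x y. \<lbrakk>x \<in> F; y \<in> F\<rbrakk> \<Longrightarrow> x \<otimes> y \<in> F"
  shows "multiplicative_conucleus A (\<lambda>x. if x \<in> F then x else 0)"
proof unfold_locales
  fix a b assume ab: "a \<in> carrier A" "b \<in> carrier A"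
  show "(if a \<in> F then a else 0) \<preceq> (if b \<in> F then b else 0)" if "a \<preceq> b"
    using that up[of a b] bounds ab by (auto simp: le_iff)
  have m: "a \<otimes> b \<le> a" "a \<otimes> b \<le> b"
    using bounds[OF ab(1)] bounds[OF ab(2)]
    by (simp_all add: mult_eq algebra_simps add_left_mono add_right_mono)
  have z: "0 \<otimes> x = 0" "x \<otimes> 0 = 0" if "x \<in> carrier A" for x
    using bounds[OF that] by (simp_all add: mult_eq)
  show "(if a \<otimes> b \<in> F then a \<otimes> b else 0) =
      (if a \<in> F then a else 0) \<otimes> (if b \<in> F then b else 0)"
    using up[OF _ m(1) ab(1)] up[OF _ m(2) ab(2)] mult[of a b] z[OF ab(1)] z[OF ab(2)] z[OF zero]
    by auto
qed (use zero bounds in \<open>auto simp: le_iff\<close>)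

end

lemma multiplicative_conucleus_cong:
  assumes "\<And>a. a \<in> carrier A \<Longrightarrow> \<delta> a = \<delta>' a"
    and "multiplicative_conucleus A \<delta>'"
  shows "multiplicative_conucleus A \<delta>"
proof -
  interpret multiplicative_conucleus A \<delta>' by fact
  show ?thesis
    by unfold_locales (use assms(1) in \<open>simp_all add: delta_closed delta_decreasing delta_mono delta_idem delta_mult\<close>)
qed

lemma (in hoop) conucleus_id: "multiplicative_conucleus A (\<lambda>x. x)"
  by unfold_locales (auto simp: hoop_le_def imp_self)

text \<open>The top element is a subalgebra by itself. This excludes the constant map to the bottom,
  which is a conucleus on the bounded chains.\<close>

lemma (in hoop) eval_const_one: "eval A (\<lambda>_. \<one>) t = \<one>"
  by (induction t) (auto simp: imp_self)


section \<open>The finite chains\<close>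

lemma Sn_sel:
  "carrier (Sn n) = {real k / real n |k. k \<le> n}"
  "x \<otimes>\<^bsub>Sn n\<^esub> y = max (x + y - 1) 0"
  "x \<leadsto>\<^bsub>Sn n\<^esub> y = min (y - x + 1) 1"
  "\<one>\<^bsub>Sn n\<^esub> = 1"
  by (simp_all add: Sn_def)

text \<open>Elements are indexed by their distance \<open>m\<close> from the top:
  \<open>1 - m/n\<close> is the \<open>m\<close>-th power of the coatom, so products become
  truncated sums of exponents and implications truncated differences.\<close>

lemma Sn_carrier_iff:
  assumes "n > 0"
  shows "x \<in> carrier (Sn n) \<longleftrightarrow> (\<exists>m\<le>n. x = 1 - real m / real n)"
proof
  assume "x \<in> carrier (Sn n)"
  then obtain k where k: "k \<le> n" "x = real k / real n"
    by (auto simp: Sn_sel)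
  then have "x = 1 - real (n - k) / real n"
    using assms by (simp add: of_nat_diff field_simps)
  then show "\<exists>m\<le>n. x = 1 - real m / real n"
    by (intro exI[of _ "n - k"]) simp
next
  assume "\<exists>m\<le>n. x = 1 - real m / real n"
  then obtain m where m: "m \<le> n" "x = 1 - real m / real n"
    by blast
  then have "x = real (n - m) / real n"
    using assms by (simp add: of_nat_diff field_simps)
  then show "x \<in> carrier (Sn n)"
    by (auto simp: Sn_sel)
qed

lemma Sn_mult_complement:
  assumes "n > 0"
  shows "(1 - real k / real n) \<otimes>\<^bsub>Sn n\<^esub> (1 - real m / real n) = 1 - real (min (k + m) n) / real n"
proof -
  have "(1 - real k / real n) + (1 - real m / real n) - 1 = 1 - real (k + m) / real n"
    by (simp add: add_divide_distrib)
  moreover have "0 \<le> 1 - real (k + m) / real n \<longleftrightarrow> k + m \<le> n"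
    using assms by (simp add: field_simps flip: of_nat_add)
  ultimately show ?thesis
    using assms by (simp add: Sn_sel max_def min_def)
qed

lemma Sn_imp_complement:
  assumes "n > 0"
  shows "(1 - real k / real n) \<leadsto>\<^bsub>Sn n\<^esub> (1 - real m / real n) = 1 - real (m - k) / real n"
proof -
  have "(1 - real m / real n) - (1 - real k / real n) + 1 = 1 - (real m - real k) / real n"
    by (simp add: diff_divide_distrib)
  moreover have "1 - (real m - real k) / real n \<le> 1 \<longleftrightarrow> k \<le> m"
    using assms by (simp add: zero_le_divide_iff)
  ultimately show ?thesis
    by (simp add: Sn_sel min_def of_nat_diff)
qed

lemma interval_hoop_Sn:
  assumes n: "n > 0"
  shows "interval_hoop (Sn n) 1"
proof
  show "carrier (Sn n) \<subseteq> {0..1}"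
    using n by (auto simp: Sn_sel)
  show "is_algebra (Sn n)"
    unfolding is_algebra_def
  proof (intro conjI ballI)
    show "\<one>\<^bsub>Sn n\<^esub> \<in> carrier (Sn n)"
      using n by (auto simp: Sn_carrier_iff Sn_sel(4) intro: exI[of _ 0])
    fix x y assume "x \<in> carrier (Sn n)" "y \<in> carrier (Sn n)"
    then obtain k m where km: "k \<le> n" "m \<le> n" "x = 1 - real k / real n" "y = 1 - real m / real n"
      using n by (auto simp: Sn_carrier_iff)
    have "m - k \<le> n" using km by simp
    then show "x \<leadsto>\<^bsub>Sn n\<^esub> y \<in> carrier (Sn n)"
      unfolding Sn_carrier_iff[OF n] km(3,4) Sn_imp_complement[OF n] by blast
    show "x \<otimes>\<^bsub>Sn n\<^esub> y \<in> carrier (Sn n)"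
      unfolding Sn_carrier_iff[OF n] km(3,4) Sn_mult_complement[OF n]
      using min.cobounded2 by blast
  qed
qed (simp_all add: Sn_sel)

lemma countable_Sn: "countable (carrier (Sn n))"
proof -
  have "carrier (Sn n) = (\<lambda>k. real k / real n) ` {..n}"
    by (auto simp: Sn_sel)
  then show ?thesis by simp
qed

text \<open>The operations do not depend on the index, and with \<open>n = d * e\<close> the element
  \<open>1 - m/d\<close> equals \<open>1 - (m * e)/n\<close>.\<close>

lemma hoop_embedding_Sn_Sn:
  assumes "d > 0" "n > 0" "d dvd n"
  shows "hoop_embedding (Sn d) (Sn n) (\<lambda>x. x)"
proof
  show "is_algebra (Sn d)"
    using interval_hoop.algebra[OF interval_hoop_Sn[OF assms(1)]] .
  show "x \<in> carrier (Sn n)" if "x \<in> carrier (Sn d)" for x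
  proof -
    obtain m where m: "m \<le> d" "x = 1 - real m / real d"
      using \<open>x \<in> carrier (Sn d)\<close> assms by (auto simp: Sn_carrier_iff)
    obtain e where e: "n = d * e"
      using assms by blast
    then have "x = 1 - real (m * e) / real n"
      using m assms by auto
    moreover have "m * e \<le> n"
      using m e by simp
    ultimately show ?thesis
      using assms by (auto simp: Sn_carrier_iff)
  qed
qed (auto simp: Sn_sel)

text \<open>For \<open>\<delta> (el 1) = el k\<close>, decrease gives \<open>k \<ge> 1\<close> and
  idempotence gives \<open>min (k * k) n = k\<close>. Without \<open>\<delta> 1 = 1\<close> the
  constant map \<open>0\<close> would be a further case.\<close>

lemma Sn_conucleus_cases:
  assumes n: "n > 0" and "multiplicative_conucleus (Sn n) \<delta>" and one: "\<delta> 1 = 1"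
  shows "(\<forall>x\<in>carrier (Sn n). \<delta> x = x) \<or> (\<forall>x\<in>carrier (Sn n). \<delta> x = (if x = 1 then 1 else 0))"
proof -
  interpret multiplicative_conucleus "Sn n" \<delta> by fact
  interpret interval_hoop "Sn n" 1 by (rule interval_hoop_Sn[OF n])
  define el where "el m = 1 - real m / real n" for m
  have el: "el m \<in> carrier (Sn n)" if "m \<le> n" for m
    using that by (auto simp: Sn_carrier_iff[OF n] el_def)
  have el_eq: "el a = el b \<longleftrightarrow> a = b" for a b
    using n by (simp add: el_def)
  obtain k where k: "k \<le> n" "\<delta> (el 1) = el k"
    using delta_closed[OF el[of 1]] n by (auto simp: Sn_carrier_iff[OF n] el_def)
  have val: "\<delta> (el m) = el (min (m * k) n)" if "m \<le> n" for m
    using that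
  proof (induction m)
    case 0
    then show ?case by (simp add: el_def one)
  next
    case (Suc m)
    have "el (Suc m) = el m \<otimes>\<^bsub>Sn n\<^esub> el 1"
      using Suc.prems Sn_mult_complement[OF n, of m 1] by (simp add: el_def)
    then have "\<delta> (el (Suc m)) = el (min (m * k) n) \<otimes>\<^bsub>Sn n\<^esub> el k"
      using Suc k n by (simp add: delta_mult el)
    also have "\<dots> = el (min (min (m * k) n + k) n)"
      unfolding el_def by (rule Sn_mult_complement[OF n])
    also have "min (min (m * k) n + k) n = min (Suc m * k) n"
      by (simp add: min_def)
    finally show ?case .
  qed
  have "el k \<le> el 1"
    using delta_decreasing[OF el[of 1]] n k by (simp add: le_iff)
  then have "k \<ge> 1"
    using n by (simp add: el_def field_simps)
  have "el (min (k * k) n) = el k"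
    using delta_idem[OF el[of 1]] n k val[OF k(1)] by simp
  then have "min (k * k) n = k"
    by (simp add: el_eq)
  then have "k * k = k \<or> k = n"
    by (auto simp: min_def split: if_splits)
  then consider "k = 1" | "k = n"
    using \<open>k \<ge> 1\<close> by auto
  then show ?thesis
  proof cases
    case 1
    have "\<forall>x\<in>carrier (Sn n). \<delta> x = x"
    proof
      fix x assume "x \<in> carrier (Sn n)"
      then obtain m where "m \<le> n" "x = el m" by (auto simp: Sn_carrier_iff[OF n] el_def)
      then show "\<delta> x = x" using val[of m] 1 by (simp add: min_def)
    qed
    then show ?thesis ..
  next
    case 2
    have "\<forall>x\<in>carrier (Sn n). \<delta> x = (if x = 1 then 1 else 0)"
    proof
      fix x assume "x \<in> carrier (Sn n)"
      then obtain m where m: "m \<le> n" "x = el m" by (auto simp: Sn_carrier_iff[OF n] el_def)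
      show "\<delta> x = (if x = 1 then 1 else 0)"
      proof (cases m)
        case 0
        then show ?thesis using m one by (simp add: el_def)
      next
        case (Suc i)
        then have "\<delta> x = el n" using val[of m] m 2 by simp
        then show ?thesis using m n Suc by (simp add: el_def)
      qed
    qed
    then show ?thesis ..
  qed
qed

lemma eval_tpow_Sn:
  assumes n: "n > 0"
  shows "eval (Sn n) (\<lambda>_. 1 - real m / real n) (tpow (Var y) k) = 1 - real (min (m * k) n) / real n"
proof (induction k)
  case 0
  then show ?case by (simp add: Sn_sel)
next
  case (Suc k)
  have "min (min (m * k) n + m) n = min (m * Suc k) n"
    by (simp add: min_def)
  then show ?case
    by (simp add: Suc Sn_mult_complement[OF n])
qed

text \<open>Below the top the distance is at least 1, so \<open>n\<close> factors already reach
  \<open>0\<close>. Larger exponents are covered because the radical term uses \<open>n + 1\<close>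
  and \<open>2 * (n + 1)\<close>.\<close>

lemma eval_tpow_Sn_eq:
  assumes n: "n > 0" "n \<le> k" and x: "x \<in> carrier (Sn n)"
  shows "eval (Sn n) (\<lambda>_. x) (tpow (Var y) k) = (if x = 1 then 1 else 0)"
proof -
  obtain m where m: "m \<le> n" "x = 1 - real m / real n"
    using x n by (auto simp: Sn_carrier_iff)
  have "n \<le> m * k" if "m > 0"
    using that n(2) by (cases m) auto
  then show ?thesis
    unfolding m(2) eval_tpow_Sn[OF n(1)] using n by auto
qed

lemma conucleus_Sn_collapse:
  assumes n: "n > 0"
  shows "multiplicative_conucleus (Sn n) (\<lambda>x. if x = 1 then 1 else 0)"
proof -
  interpret interval_hoop "Sn n" 1 by (rule interval_hoop_Sn[OF n])
  have "multiplicative_conucleus (Sn n) (\<lambda>x. if x \<in> {1} then x else 0)"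
    by (rule conucleus_collapse) (use n bounds in \<open>force simp: Sn_sel\<close>)+
  then show ?thesis
    by (rule multiplicative_conucleus_cong[rotated]) simp
qed


section \<open>The negative cone of the integers\<close>

lemma S_omega_sel:
  "carrier S_omega = UNIV" "x \<otimes>\<^bsub>S_omega\<^esub> y = x + y" "x \<leadsto>\<^bsub>S_omega\<^esub> y = y - x" "\<one>\<^bsub>S_omega\<^esub> = 0"
  by (simp_all add: S_omega_def)

lemma hoop_S_omega: "hoop S_omega"
  by unfold_locales (auto simp: S_omega_sel Units_def)

text \<open>The hoop order reverses that of \<open>nat\<close>, so decrease means
  \<open>\<delta> 1 \<ge> 1\<close>. Additivity makes \<open>\<delta>\<close> the multiplication by
  \<open>\<delta> 1\<close>, and idempotence forces
  \<open>\<delta> 1 * \<delta> 1 = \<delta> 1\<close>.\<close>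

lemma S_omega_conucleus_id:
  assumes "multiplicative_conucleus S_omega \<delta>" and zero: "\<delta> 0 = 0"
  shows "\<delta> m = m"
proof -
  interpret multiplicative_conucleus S_omega \<delta> by fact
  have val: "\<delta> m = m * \<delta> 1" for m
  proof (induction m)
    case (Suc m)
    have "\<delta> (m + 1) = \<delta> m + \<delta> 1"
      using delta_mult[of m 1] by (simp add: S_omega_sel)
    then show ?case using Suc by simp
  qed (simp add: zero)
  have "\<delta> 1 \<ge> 1"
    using delta_decreasing[of 1] by (simp add: S_omega_sel hoop_le_def)
  moreover have "\<delta> 1 * \<delta> 1 = \<delta> 1"
    using delta_idem[of 1] by (simp only: S_omega_sel UNIV_I val[of "\<delta> 1", symmetric])
  ultimately have "\<delta> 1 = 1"
    by (metis mult_cancel2 nat_mult_1 not_one_le_zero)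
  then show ?thesis
    using val[of m] by simp
qed


section \<open>The infinite chains with radical\<close>

lemma Sn_omega_carrier_iff:
  "(a, b) \<in> carrier (Sn_omega n) \<longleftrightarrow>
    (0 < a \<or> a = 0 \<and> 0 \<le> b) \<and> (a < int n \<or> a = int n \<and> b \<le> 0)"
  by (auto simp: Sn_omega_def less_eq_prod_def)

lemma Sn_omega_sel:
  "carrier (Sn_omega n) = {0..(int n, 0)}"
  "x \<otimes>\<^bsub>Sn_omega n\<^esub> y = max (x + y - (int n, 0)) 0"
  "x \<leadsto>\<^bsub>Sn_omega n\<^esub> y = min (y - x + (int n, 0)) (int n, 0)"
  "\<one>\<^bsub>Sn_omega n\<^esub> = (int n, 0)"
proof -
  show "x \<otimes>\<^bsub>Sn_omega n\<^esub> y = max (x + y - (int n, 0)) 0"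
    by (cases x; cases y)
      (auto simp: Sn_omega_def mv_neg_def mv_plus_def max_def min_def less_eq_prod_def zero_prod_def)
qed (simp_all add: Sn_omega_def mv_neg_def mv_plus_def zero_prod_def algebra_simps)

lemma Sn_omega_mult_pair:
  "(a, b) \<otimes>\<^bsub>Sn_omega n\<^esub> (c, d) =
    (if a + c < int n \<or> a + c = int n \<and> b + d < 0 then (0, 0) else (a + c - int n, b + d))"
  by (auto simp: Sn_omega_sel(2) max_def less_eq_prod_def zero_prod_def)

lemma Sn_omega_imp_pair:
  "(a, b) \<leadsto>\<^bsub>Sn_omega n\<^esub> (c, d) =
    (if a < c \<or> a = c \<and> b \<le> d then (int n, 0) else (c - a + int n, d - b))"
  by (auto simp: Sn_omega_sel(3) min_def less_eq_prod_def)

lemma interval_hoop_Sn_omega: "interval_hoop (Sn_omega n) (int n, 0)"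
proof
  show "is_algebra (Sn_omega n)"
    unfolding is_algebra_def
  proof (intro conjI ballI)
    show "\<one>\<^bsub>Sn_omega n\<^esub> \<in> carrier (Sn_omega n)"
      unfolding Sn_omega_sel(4) Sn_omega_carrier_iff by arith
    fix x y assume xy: "x \<in> carrier (Sn_omega n)" "y \<in> carrier (Sn_omega n)"
    obtain a b c d where p: "x = (a, b)" "y = (c, d)"
      by (cases x; cases y)
    show "x \<otimes>\<^bsub>Sn_omega n\<^esub> y \<in> carrier (Sn_omega n)"
      using xy unfolding p Sn_omega_mult_pair
      by (simp only: Sn_omega_carrier_iff split: if_split) arith
    show "x \<leadsto>\<^bsub>Sn_omega n\<^esub> y \<in> carrier (Sn_omega n)"
      using xy unfolding p Sn_omega_imp_pair
      by (simp only: Sn_omega_carrier_iff split: if_split) arith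
  qed
qed (simp_all add: Sn_omega_sel)

section \<open>Subalgebras of the chain with radical\<close>

text \<open>The image is the skeleton, the elements with second coordinate 0. On the carrier
  \<open>x * real n\<close> is an integer, so the floor only changes the type.\<close>

lemma hoop_embedding_Sn_Sn_omega:
  assumes n: "n > 0"
  shows "hoop_embedding (Sn n) (Sn_omega n) (\<lambda>x. (\<lfloor>x * real n\<rfloor>, 0))"
proof
  define h where "h x = (\<lfloor>x * real n\<rfloor>, 0::int)" for x :: real
  have h: "h (1 - real m / real n) = (int n - int m, 0)" for m
  proof -
    have "(1 - real m / real n) * real n = of_int (int n - int m)"
      using n by (simp add: field_simps)
    then show ?thesis by (simp only: h_def floor_of_int)
  qed
  show "is_algebra (Sn n)"
    by (rule interval_hoop.algebra[OF interval_hoop_Sn[OF n]])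
  show "inj_on (\<lambda>x. (\<lfloor>x * real n\<rfloor>, 0::int)) (carrier (Sn n))"
    unfolding h_def[symmetric] by (auto simp: inj_on_def Sn_carrier_iff[OF n] h)
  show "(\<lfloor>\<one>\<^bsub>Sn n\<^esub> * real n\<rfloor>, 0) = \<one>\<^bsub>Sn_omega n\<^esub>"
    by (simp add: Sn_sel Sn_omega_sel)
  fix x assume "x \<in> carrier (Sn n)"
  then obtain k where k: "k \<le> n" "x = 1 - real k / real n"
    using n by (auto simp: Sn_carrier_iff)
  then show "(\<lfloor>x * real n\<rfloor>, 0) \<in> carrier (Sn_omega n)"
    unfolding h_def[symmetric] by (auto simp: h Sn_omega_carrier_iff)
  fix y assume "y \<in> carrier (Sn n)"
  then obtain m where m: "m \<le> n" "y = 1 - real m / real n"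
    using n by (auto simp: Sn_carrier_iff)
  show "(\<lfloor>(x \<otimes>\<^bsub>Sn n\<^esub> y) * real n\<rfloor>, 0) =
      (\<lfloor>x * real n\<rfloor>, 0) \<otimes>\<^bsub>Sn_omega n\<^esub> (\<lfloor>y * real n\<rfloor>, 0)"
    unfolding h_def[symmetric] k m Sn_mult_complement[OF n] h by (auto simp: Sn_omega_mult_pair)
  show "(\<lfloor>(x \<leadsto>\<^bsub>Sn n\<^esub> y) * real n\<rfloor>, 0) =
      (\<lfloor>x * real n\<rfloor>, 0) \<leadsto>\<^bsub>Sn_omega n\<^esub> (\<lfloor>y * real n\<rfloor>, 0)"
    unfolding h_def[symmetric] k m Sn_imp_complement[OF n] h by (auto simp: Sn_omega_imp_pair)
qed

text \<open>The image is the radical. The sign is reversed because larger numbers are lower in the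
  order of \<open>S_omega\<close>.\<close>

lemma hoop_embedding_S_omega_Sn_omega:
  assumes "n > 0"
  shows "hoop_embedding S_omega (Sn_omega n) (\<lambda>m. (int n, - int m))"
  by unfold_locales (use assms hoop_is_algebra[OF hoop_S_omega] in
    \<open>auto simp: inj_on_def S_omega_sel Sn_omega_carrier_iff Sn_omega_mult_pair Sn_omega_imp_pair
      Sn_omega_sel(4)\<close>)

text \<open>The first coordinates 0 and 1 go to 0 and \<open>n\<close>; the image consists of the
  elements infinitely close to the bottom or to the top.\<close>

lemma hoop_embedding_Sn_omega_1:
  assumes "n > 0"
  shows "hoop_embedding (Sn_omega 1) (Sn_omega n) (map_prod ((*) (int n)) (\<lambda>b. b))"
proof
  have mem: "a = 0 \<and> 0 \<le> b \<or> a = 1 \<and> b \<le> 0" if "(a, b) \<in> carrier (Sn_omega 1)" for a b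
    using that unfolding Sn_omega_carrier_iff by arith
  show "is_algebra (Sn_omega 1)"
    by (rule interval_hoop.algebra[OF interval_hoop_Sn_omega])
  show "inj_on (map_prod ((*) (int n)) (\<lambda>b. b)) (carrier (Sn_omega 1))"
    using assms by (auto simp: inj_on_def)
  show "map_prod ((*) (int n)) (\<lambda>b. b) \<one>\<^bsub>Sn_omega 1\<^esub> = \<one>\<^bsub>Sn_omega n\<^esub>"
    by (simp add: Sn_omega_sel)
  fix x assume x: "x \<in> carrier (Sn_omega 1)"
  obtain a b where ab: "x = (a, b)"
    by (cases x)
  show "map_prod ((*) (int n)) (\<lambda>b. b) x \<in> carrier (Sn_omega n)"
    using assms mem[OF x[unfolded ab]] unfolding ab
    by (elim disjE) (simp_all add: Sn_omega_carrier_iff)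
  fix y assume y: "y \<in> carrier (Sn_omega 1)"
  obtain c d where cd: "y = (c, d)"
    by (cases y)
  show "map_prod ((*) (int n)) (\<lambda>b. b) (x \<otimes>\<^bsub>Sn_omega 1\<^esub> y) =
      map_prod ((*) (int n)) (\<lambda>b. b) x \<otimes>\<^bsub>Sn_omega n\<^esub> map_prod ((*) (int n)) (\<lambda>b. b) y"
    using assms mem[OF x[unfolded ab]] mem[OF y[unfolded cd]] unfolding ab cd
    by (elim disjE) (simp_all add: Sn_omega_mult_pair)
  show "map_prod ((*) (int n)) (\<lambda>b. b) (x \<leadsto>\<^bsub>Sn_omega 1\<^esub> y) =
      map_prod ((*) (int n)) (\<lambda>b. b) x \<leadsto>\<^bsub>Sn_omega n\<^esub> map_prod ((*) (int n)) (\<lambda>b. b) y"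
    using assms mem[OF x[unfolded ab]] mem[OF y[unfolded cd]] unfolding ab cd
    by (elim disjE) (simp_all add: Sn_omega_imp_pair)
qed

lemma countable_Sn_omega: "countable (carrier (Sn_omega n))"
  by (rule countable_subset[OF subset_UNIV]) simp

section \<open>The radical conucleus and its term\<close>

lemma conucleus_Sn_omega_radical:
  assumes n: "n > 0"
  shows "multiplicative_conucleus (Sn_omega n) (\<lambda>x. if fst x = int n then x else 0)"
proof -
  interpret interval_hoop "Sn_omega n" "(int n, 0)" by (rule interval_hoop_Sn_omega)
  have "multiplicative_conucleus (Sn_omega n)
    (\<lambda>x. if x \<in> {x \<in> carrier (Sn_omega n). fst x = int n} then x else 0)"
  proof (rule conucleus_collapse)
    show "0 \<in> carrier (Sn_omega n)"
      by (simp add: Sn_omega_sel(1) less_eq_prod_def zero_prod_def)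
    show "(int n, 0) \<in> {x \<in> carrier (Sn_omega n). fst x = int n}"
      using n by (simp add: Sn_omega_carrier_iff)
    show "y \<in> {x \<in> carrier (Sn_omega n). fst x = int n}"
      if "x \<in> {x \<in> carrier (Sn_omega n). fst x = int n}" "x \<le> y" "y \<in> carrier (Sn_omega n)"
      for x y
      using that n by (cases x; cases y) (auto simp: Sn_omega_carrier_iff less_eq_prod_def)
    show "x \<otimes>\<^bsub>Sn_omega n\<^esub> y \<in> {x \<in> carrier (Sn_omega n). fst x = int n}"
      if "x \<in> {x \<in> carrier (Sn_omega n). fst x = int n}"
        "y \<in> {x \<in> carrier (Sn_omega n). fst x = int n}" for x y
      using that n by (cases x; cases y) (auto simp: Sn_omega_carrier_iff Sn_omega_mult_pair)
  qed
  then show ?thesis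
    by (rule multiplicative_conucleus_cong[rotated]) simp
qed

lemma eval_tpow_Sn_omega_radical:
  assumes "n > 0" "b \<le> 0"
  shows "eval (Sn_omega n) (\<lambda>_. (int n, b)) (tpow (Var y) k) = (int n, int k * b)"
proof (induction k)
  case (Suc k)
  have "\<not> int k * b + b > 0"
    using assms by (simp add: mult_nonneg_nonpos add_nonpos_nonpos not_less)
  then show ?case
    using assms Suc by (simp add: Sn_omega_mult_pair algebra_simps)
qed (simp add: Sn_omega_sel)

text \<open>Each factor lowers the first coordinate by at least 1, so more than \<open>n\<close>
  factors are truncated to \<open>0\<close>. Exponent \<open>n\<close> would not suffice: the
  \<open>n\<close>-th power of \<open>(n - 1, b)\<close> with \<open>b > 0\<close> is
  \<open>(0, n * b)\<close>.\<close>

lemma eval_tpow_Sn_omega_nonradical: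
  assumes a: "0 \<le> a" "a < int n" and k: "k > n"
  shows "eval (Sn_omega n) (\<lambda>_. (a, b)) (tpow (Var y) k) = 0"
proof -
  have "fst (eval (Sn_omega n) (\<lambda>_. (a, b)) (tpow (Var y) k)) \<le> int n - int k \<or>
      eval (Sn_omega n) (\<lambda>_. (a, b)) (tpow (Var y) k) = (0, 0)" for k
  proof (induction k)
    case (Suc k)
    obtain c d where cd: "eval (Sn_omega n) (\<lambda>_. (a, b)) (tpow (Var y) k) = (c, d)"
      by fastforce
    show ?case
      using Suc a by (auto simp: cd Sn_omega_mult_pair)
  qed (simp add: Sn_omega_sel)
  from this[of k] k have "fst (eval (Sn_omega n) (\<lambda>_. (a, b)) (tpow (Var y) k)) < 0 \<or>
      eval (Sn_omega n) (\<lambda>_. (a, b)) (tpow (Var y) k) = 0"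
    by (auto simp: zero_prod_def)
  moreover have "eval (Sn_omega n) (\<lambda>_. (a, b)) (tpow (Var y) k) \<ge> 0"
    using k by (cases k) (simp_all add: Sn_omega_sel(2))
  ultimately show ?thesis
    by (auto simp: less_eq_prod_def)
qed

text \<open>On the radical put \<open>p = (n + 1) * b\<close>: the inner implication from
  \<open>(n, p)\<close> to \<open>(n, 2 * p)\<close> is again \<open>(n, p)\<close>, so the outer
  one is the top and the product is \<open>x\<close>. Outside it both powers vanish, the inner
  implication is the top, the outer one is \<open>0\<close>, and so is the product.\<close>

lemma eval_radical_term:
  assumes n: "n > 0" and x: "x \<in> carrier (Sn_omega n)"
  shows "eval (Sn_omega n) (\<lambda>_. x) (Var y \<odot>
      ((tpow (Var y) (n + 1) \<rightarrow>\<^sub>t tpow (Var y) (2 * (n + 1))) \<rightarrow>\<^sub>t tpow (Var y) (n + 1))) =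
    (if fst x = int n then x else 0)"
proof -
  obtain a b where ab: "x = (a, b)"
    by (cases x)
  show ?thesis
  proof (cases "a = int n")
    case True
    then have b: "b \<le> 0"
      using x n by (simp add: ab Sn_omega_carrier_iff)
    define p where "p = int (n + 1) * b"
    have p: "p \<le> 0" "int (2 * (n + 1)) * b = 2 * p"
      unfolding p_def using b by (rule mult_nonneg_nonpos[rotated]) simp_all
    show ?thesis
      unfolding ab True eval.simps eval_tpow_Sn_omega_radical[OF n b] p(2) p_def[symmetric]
      using p b n by (simp add: Sn_omega_imp_pair Sn_omega_mult_pair)
  next
    case False
    then have a: "0 \<le> a" "a < int n"
      using x by (auto simp: ab Sn_omega_carrier_iff)
    have "eval (Sn_omega n) (\<lambda>_. (a, b)) (tpow (Var y) (n + 1)) = 0"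
        "eval (Sn_omega n) (\<lambda>_. (a, b)) (tpow (Var y) (2 * (n + 1))) = 0"
      by (rule eval_tpow_Sn_omega_nonradical[OF a]; simp)+
    then show ?thesis
      unfolding ab eval.simps
      using a False by (simp add: zero_prod_def Sn_omega_imp_pair Sn_omega_mult_pair)
  qed
qed

section \<open>Classification on the chain with radical\<close>

text \<open>The hypotheses \<open>rad\<close> and \<open>fin\<close> are what a term map inherits
  from the radical and the skeleton. Multiplication by radical elements spreads these values over
  the chain.\<close>

lemma Sn_omega_conucleus_cases:
  assumes n: "n > 0" and "multiplicative_conucleus (Sn_omega n) \<delta>"
    and rad: "\<And>b. b \<le> 0 \<Longrightarrow> \<delta> (int n, b) = (int n, b)"
    and fin: "(\<forall>a. 0 \<le> a \<and> a \<le> int n \<longrightarrow> \<delta> (a, 0) = (a, 0)) \<or>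
      (\<forall>a. 0 \<le> a \<and> a < int n \<longrightarrow> \<delta> (a, 0) = 0)"
  shows "(\<forall>x\<in>carrier (Sn_omega n). \<delta> x = x) \<or>
    (\<forall>x\<in>carrier (Sn_omega n). \<delta> x = (if fst x = int n then x else 0))"
proof -
  interpret multiplicative_conucleus "Sn_omega n" \<delta> by fact
  interpret interval_hoop "Sn_omega n" "(int n, 0)" by (rule interval_hoop_Sn_omega)
  have lower: "\<delta> x = 0" if "\<delta> y = 0" "x \<le> y" "x \<in> carrier (Sn_omega n)" "y \<in> carrier (Sn_omega n)"
    for x y
    using delta_mono[of x y] that bounds(1)[OF delta_closed[of x]] by (simp add: le_iff)
  \<comment> \<open>Multiplying by the fixed element \<open>(n, - c)\<close> lowers the second
    coordinate by \<open>c\<close>, and for \<open>c \<le> b\<close> nothing is truncated on the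
    argument side.\<close>
  have shift: "\<delta> (a, b) \<otimes>\<^bsub>Sn_omega n\<^esub> (int n, - c) = \<delta> (a, b - c)"
    if "0 \<le> c" "c \<le> b" "(a, b) \<in> carrier (Sn_omega n)" for a b c
  proof -
    have mem: "(int n, - c) \<in> carrier (Sn_omega n)"
      using n that by (simp add: Sn_omega_carrier_iff)
    have "(a, b) \<otimes>\<^bsub>Sn_omega n\<^esub> (int n, - c) = (a, b - c)"
      using that unfolding Sn_omega_mult_pair Sn_omega_carrier_iff by auto
    then show ?thesis
      using delta_mult[OF that(3) mem] rad[of "- c"] that by simp
  qed
  consider "n \<ge> 2" "\<And>a. \<lbrakk>0 \<le> a; a \<le> int n\<rbrakk> \<Longrightarrow> \<delta> (a, 0) = (a, 0)"
    | "n \<ge> 2" "\<And>a. \<lbrakk>0 \<le> a; a < int n\<rbrakk> \<Longrightarrow> \<delta> (a, 0) = 0"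
    | "n = 1"
    using n fin by fastforce
  then show ?thesis
  proof cases
    case 1
    have pos: "\<delta> (a, b) = (a, b)" if "0 < a" and mem: "(a, b) \<in> carrier (Sn_omega n)" for a b
    proof (cases "b \<le> 0")
      case True
      have a: "a \<le> int n"
        using mem by (auto simp: Sn_omega_carrier_iff)
      have "(a, 0) \<otimes>\<^bsub>Sn_omega n\<^esub> (int n, b) = (a, b)"
        using \<open>0 < a\<close> by (simp add: Sn_omega_mult_pair)
      moreover have "(a, 0) \<in> carrier (Sn_omega n)" "(int n, b) \<in> carrier (Sn_omega n)"
        using \<open>0 < a\<close> a n True by (auto simp: Sn_omega_carrier_iff)
      ultimately show ?thesis
        using delta_mult[of "(a, 0)" "(int n, b)"] 1(2)[of a] rad[OF True] \<open>0 < a\<close> a by simp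
    next
      case False
      then have a: "a < int n"
        using mem by (auto simp: Sn_omega_carrier_iff)
      obtain p q where pq: "\<delta> (a, b) = (p, q)"
        by fastforce
      \<comment> \<open>As \<open>a > 0\<close>, this product is not the truncated value
        \<open>(0, 0)\<close>, so both coordinates can be read off: \<open>p = a\<close> and
        \<open>q = b\<close>.\<close>
      have "(p, q) \<otimes>\<^bsub>Sn_omega n\<^esub> (int n, - b) = (a, 0)"
        using shift[of b b a] False mem 1(2)[of a] a \<open>0 < a\<close> by (simp add: pq)
      then show ?thesis
        using \<open>0 < a\<close> by (simp add: pq Sn_omega_mult_pair split: if_splits)
    qed
    have "\<delta> (a, b) = (a, b)" if mem: "(a, b) \<in> carrier (Sn_omega n)" for a b
    proof (cases "a = 0")
      case True
      then have b: "0 \<le> b"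
        using mem n by (auto simp: Sn_omega_carrier_iff)
      \<comment> \<open>For first coordinate 0 the shift to \<open>(0, 0)\<close> may hide a
        truncation. The factors chosen here have positive first coordinates because
        \<open>n \<ge> 2\<close>.\<close>
      have prod: "(1, 0) \<otimes>\<^bsub>Sn_omega n\<^esub> (int n - 1, b) = (0, b)"
        using b by (simp add: Sn_omega_mult_pair)
      have mems: "(1, 0) \<in> carrier (Sn_omega n)" "(int n - 1, b) \<in> carrier (Sn_omega n)"
        using 1(1) b by (simp_all add: Sn_omega_carrier_iff)
      have "\<delta> (0, b) = (1, 0) \<otimes>\<^bsub>Sn_omega n\<^esub> (int n - 1, b)"
        using delta_mult[OF mems] pos[OF _ mems(1)] pos[OF _ mems(2)] 1(1) by (simp add: prod)
      then show ?thesis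
        by (simp add: prod True)
    next
      case False
      then show ?thesis
        using mem pos[of a b] by (auto simp: Sn_omega_carrier_iff)
    qed
    then show ?thesis by auto
  next
    case 2
    have "\<delta> (a, b) = 0" if mem: "(a, b) \<in> carrier (Sn_omega n)" and a: "a < int n" for a b
    proof -
      have a0: "0 \<le> a"
        using mem by (auto simp: Sn_omega_carrier_iff)
      \<comment> \<open>Raising a negative second coordinate to 0 makes \<open>shift\<close>
        applicable; monotonicity brings the result back down to \<open>(a, b)\<close>.\<close>
      have mem': "(a, max b 0) \<in> carrier (Sn_omega n)"
        using a a0 by (auto simp: Sn_omega_carrier_iff)
      obtain p q where pq: "\<delta> (a, max b 0) = (p, q)"
        by fastforce
      have "(p, q) \<otimes>\<^bsub>Sn_omega n\<^esub> (int n, - max b 0) = (0, 0)"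
        using shift[of "max b 0" "max b 0" a] mem' 2(2)[OF a0 a] by (simp add: pq zero_prod_def)
      then have "p \<le> 0"
        by (auto simp: Sn_omega_mult_pair split: if_splits)
      have pq_mem: "(p, q) \<in> carrier (Sn_omega n)"
        using delta_closed[OF mem'] by (simp add: pq)
      have one_mem: "(1, 0) \<in> carrier (Sn_omega n)"
        using 2(1) by (simp add: Sn_omega_carrier_iff)
      \<comment> \<open>The shift only yields \<open>p \<le> 0\<close>. So \<open>(p, q)\<close>
        lies below the skeleton element \<open>(1, 0)\<close>, which is sent to \<open>0\<close>
        because \<open>n \<ge> 2\<close>; idempotence turns this into
        \<open>(p, q) = 0\<close>.\<close>
      have "\<delta> (p, q) = 0"
        by (rule lower[OF _ _ pq_mem one_mem])
          (use 2 \<open>p \<le> 0\<close> in \<open>simp_all add: less_eq_prod_def\<close>)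
      then have "\<delta> (a, max b 0) = 0"
        using delta_idem[OF mem'] by (simp add: pq)
      then show ?thesis
        by (rule lower[OF _ _ mem mem']) (simp add: less_eq_prod_def)
    qed
    moreover have "\<delta> (a, b) = (a, b)" if "(a, b) \<in> carrier (Sn_omega n)" "a = int n" for a b
      using that rad by (simp add: Sn_omega_carrier_iff)
    ultimately have "\<delta> (a, b) = (if a = int n then (a, b) else 0)"
      if "(a, b) \<in> carrier (Sn_omega n)" for a b
      using that by (cases "a = int n") (auto simp: Sn_omega_carrier_iff)
    then show ?thesis by auto
  next
    case 3
    txt \<open>Here the skeleton \<open>S\<^sub>1\<close> does not separate the two alternatives; the value at the
      least nonzero element \<open>(0, 1)\<close> does.\<close>
    have mem0: "(0, b) \<in> carrier (Sn_omega n) \<longleftrightarrow> 0 \<le> b" for b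
      using 3 by (simp add: Sn_omega_carrier_iff)
    have top: "\<delta> (a, b) = (a, b)" if "(a, b) \<in> carrier (Sn_omega n)" "a \<noteq> 0" for a b
    proof -
      have "a = int n" "b \<le> 0"
        using that 3 by (auto simp: Sn_omega_carrier_iff)
      then show ?thesis by (simp add: rad)
    qed
    have bot: "\<exists>q. 0 \<le> q \<and> q \<le> b \<and> \<delta> (0, b) = (0, q)" if "0 \<le> b" for b
    proof -
      obtain p q where pq: "\<delta> (0, b) = (p, q)"
        by fastforce
      then have "(0, 0) \<le> (p, q)" "(p, q) \<le> (0, b)"
        using delta_closed[of "(0, b)"] delta_decreasing[of "(0, b)"] that bounds(1)[of "(p, q)"]
        by (simp_all add: mem0 le_iff zero_prod_def)
      then show ?thesis
        using pq by (auto simp: less_eq_prod_def)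
    qed
    show ?thesis
    proof (cases "\<delta> (0, 1) = (0, 1)")
      case True
      have "\<delta> (0, b) = (0, b)" if b: "0 \<le> b" for b
      proof (cases "b = 0")
        case False
        obtain q where q: "0 \<le> q" "\<delta> (0, b) = (0, q)"
          using bot[OF b] by blast
        \<comment> \<open>A shift by \<open>b - 1\<close> takes \<open>(0, b)\<close> to the fixed
          atom \<open>(0, 1)\<close>. The result is nonzero, hence not truncated, and
          \<open>q = b\<close> follows.\<close>
        have "(0, q) \<otimes>\<^bsub>Sn_omega n\<^esub> (int n, - (b - 1)) = (0, 1)"
          using shift[of "b - 1" b 0] b False True by (simp add: q mem0)
        then show ?thesis
          by (simp add: q Sn_omega_mult_pair split: if_splits)
      qed (use bot[of 0] in auto)
      then have "\<delta> (a, b) = (a, b)" if "(a, b) \<in> carrier (Sn_omega n)" for a b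
        using top[OF that] that mem0 by (cases "a = 0") auto
      then show ?thesis by auto
    next
      case False
      have "\<delta> (0, b) = 0" if b: "0 \<le> b" for b
      proof -
        obtain q where q: "0 \<le> q" "\<delta> (0, b) = (0, q)"
          using bot[OF b] by blast
        have idem: "\<delta> (0, q) = (0, q)"
          using delta_idem[of "(0, b)"] b by (simp add: q mem0)
        \<comment> \<open>A nonzero fixed point \<open>(0, q)\<close> could be shifted down by
          \<open>q - 1\<close> to the atom, which would then be fixed too.\<close>
        have "q = 0"
        proof (rule ccontr)
          assume "q \<noteq> 0"
          then have "\<delta> (0, 1) = (0, q) \<otimes>\<^bsub>Sn_omega n\<^esub> (int n, - (q - 1))"
            using shift[of "q - 1" q 0] q(1) idem by (simp add: mem0)
          also have "\<dots> = (0, 1)"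
            by (simp add: Sn_omega_mult_pair)
          finally show False
            using False by simp
        qed
        then show ?thesis
          by (simp add: q zero_prod_def)
      qed
      then have "\<delta> (a, b) = (if a = int n then (a, b) else 0)"
        if "(a, b) \<in> carrier (Sn_omega n)" for a b
        using top[OF that] that 3 mem0 by (cases "a = 0") (auto simp: Sn_omega_carrier_iff)
      then show ?thesis by auto
    qed
  qed
qed


section \<open>Conucleus terms on the generators\<close>

abbreviation conucleus_on :: "('a, 'b) hoop_scheme \<Rightarrow> nat hterm \<Rightarrow> bool" where
  "conucleus_on A t \<equiv> multiplicative_conucleus A (\<lambda>a. eval A (\<lambda>_. a) t)"

abbreviation radical_term :: "nat \<Rightarrow> nat hterm" where
  "radical_term j \<equiv> Var 0 \<odot>
    ((tpow (Var 0) (j + 1) \<rightarrow>\<^sub>t tpow (Var 0) (2 * (j + 1))) \<rightarrow>\<^sub>t tpow (Var 0) (j + 1))"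

lemma vars_tpow_Var: "vars (tpow (Var 0) n) \<subseteq> {0}"
  using vars_tpow[of "Var 0" n] by simp

lemma vars_radical_term: "vars (radical_term j) \<subseteq> {0}"
  unfolding hterm.set using vars_tpow_Var by blast

lemma satisfies_Var_iff:
  fixes t :: "nat hterm"
  assumes "vars t \<subseteq> {0}"
  shows "A \<Turnstile> t \<approx> Var 0 \<longleftrightarrow> (\<forall>a\<in>carrier A. eval A (\<lambda>_. a) t = a)"
  using satisfies_unary_iff[OF assms, of "Var 0" A] by simp

lemma Sn_satisfies_power_iff:
  fixes t :: "nat hterm"
  assumes "vars t \<subseteq> {0}" "n > 0"
  shows "Sn n \<Turnstile> t \<approx> tpow (Var 0) n \<longleftrightarrow>
    (\<forall>a\<in>carrier (Sn n). eval (Sn n) (\<lambda>_. a) t = (if a = 1 then 1 else 0))"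
  unfolding satisfies_unary_iff[OF assms(1) vars_tpow_Var]
  by (intro ball_cong) (simp_all only: eval_tpow_Sn_eq[OF assms(2) order_refl])

lemma Sn_omega_satisfies_radical_iff:
  fixes t :: "nat hterm"
  assumes "vars t \<subseteq> {0}" "n > 0"
  shows "Sn_omega n \<Turnstile> t \<approx> radical_term n \<longleftrightarrow>
    (\<forall>a\<in>carrier (Sn_omega n). eval (Sn_omega n) (\<lambda>_. a) t = (if fst a = int n then a else 0))"
  unfolding satisfies_unary_iff[OF assms(1) vars_radical_term]
  by (intro ball_cong) (simp_all only: eval_radical_term[OF assms(2)])

lemma Sn_conucleus_iff:
  assumes t: "vars t \<subseteq> {0}" and n: "n > 0"
  shows "conucleus_on (Sn n) t \<longleftrightarrow> Sn n \<Turnstile> t \<approx> Var 0 \<or> Sn n \<Turnstile> t \<approx> tpow (Var 0) n"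
    (is "?L \<longleftrightarrow> ?R")
proof
  interpret interval_hoop "Sn n" 1 by (rule interval_hoop_Sn[OF n])
  show ?R if ?L
    using Sn_conucleus_cases[OF n that] eval_const_one[of t]
    by (simp add: satisfies_Var_iff[OF t] Sn_satisfies_power_iff[OF t n] Sn_sel(4))
  show ?L if ?R
    using that
  proof
    assume "Sn n \<Turnstile> t \<approx> Var 0"
    then show ?L
      using multiplicative_conucleus_cong[OF _ conucleus_id] by (simp add: satisfies_Var_iff[OF t])
  next
    assume "Sn n \<Turnstile> t \<approx> tpow (Var 0) n"
    then show ?L
      using multiplicative_conucleus_cong[OF _ conucleus_Sn_collapse[OF n]]
      by (simp add: Sn_satisfies_power_iff[OF t n])
  qed
qed

lemma S_omega_conucleus_iff:
  assumes t: "vars t \<subseteq> {0}"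
  shows "conucleus_on S_omega t \<longleftrightarrow> S_omega \<Turnstile> t \<approx> Var 0"
proof
  interpret hoop S_omega by (rule hoop_S_omega)
  show "S_omega \<Turnstile> t \<approx> Var 0" if "conucleus_on S_omega t"
    using S_omega_conucleus_id[OF that] eval_const_one[of t]
    by (simp add: satisfies_Var_iff[OF t] S_omega_sel)
  show "conucleus_on S_omega t" if "S_omega \<Turnstile> t \<approx> Var 0"
    using that multiplicative_conucleus_cong[OF _ conucleus_id] by (simp add: satisfies_Var_iff[OF t])
qed

lemma Sn_omega_conucleus_iff:
  assumes t: "vars t \<subseteq> {0}" and n: "n > 0"
  shows "conucleus_on (Sn_omega n) t \<longleftrightarrow>
    Sn_omega n \<Turnstile> t \<approx> Var 0 \<or> Sn_omega n \<Turnstile> t \<approx> radical_term n"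
    (is "?L \<longleftrightarrow> ?R")
proof
  interpret interval_hoop "Sn_omega n" "(int n, 0)" by (rule interval_hoop_Sn_omega)
  show ?R if L: ?L
  proof -
    txt \<open>A term map restricts to both subalgebras; an arbitrary conucleus need not.\<close>
    interpret radical: hoop_embedding S_omega "Sn_omega n" "\<lambda>m. (int n, - int m)"
      by (rule hoop_embedding_S_omega_Sn_omega[OF n])
    interpret skeleton: hoop_embedding "Sn n" "Sn_omega n" "\<lambda>x. (\<lfloor>x * real n\<rfloor>, 0)"
      by (rule hoop_embedding_Sn_Sn_omega[OF n])
    have h: "(\<lfloor>(1 - real m / real n) * real n\<rfloor>, 0) = (int n - int m, 0::int)" for m
    proof -
      have "(1 - real m / real n) * real n = of_int (int n - int m)"
        using n by (simp add: field_simps)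
      then show ?thesis by (simp only: floor_of_int)
    qed
    have rad: "eval (Sn_omega n) (\<lambda>_. (int n, b)) t = (int n, b)" if "b \<le> 0" for b
    proof -
      have "eval S_omega (\<lambda>_. nat (- b)) t = nat (- b)"
        using radical.conucleus_reflect[OF L]
        by (simp add: S_omega_conucleus_iff[OF t] satisfies_Var_iff[OF t] S_omega_sel)
      then show ?thesis
        using radical.hom_eval[of "\<lambda>_. nat (- b)" t] that by (simp add: S_omega_sel)
    qed
    have val: "eval (Sn_omega n) (\<lambda>_. (int n - int m, 0)) t =
        (\<lfloor>eval (Sn n) (\<lambda>_. 1 - real m / real n) t * real n\<rfloor>, 0)" if "m \<le> n" for m
      using skeleton.hom_eval[of "\<lambda>_. 1 - real m / real n" t] that n
      by (auto simp: Sn_carrier_iff h)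
    have mem: "1 - real m / real n \<in> carrier (Sn n)" if "m \<le> n" for m
      using that n by (auto simp: Sn_carrier_iff)
    have "Sn n \<Turnstile> t \<approx> Var 0 \<or> Sn n \<Turnstile> t \<approx> tpow (Var 0) n"
      using skeleton.conucleus_reflect[OF L] Sn_conucleus_iff[OF t n] by simp
    then have "(\<forall>m\<le>n. eval (Sn_omega n) (\<lambda>_. (int n - int m, 0)) t = (int n - int m, 0)) \<or>
        (\<forall>m\<le>n. m > 0 \<longrightarrow> eval (Sn_omega n) (\<lambda>_. (int n - int m, 0)) t = 0)"
    proof
      assume "Sn n \<Turnstile> t \<approx> Var 0"
      then have "eval (Sn n) (\<lambda>_. 1 - real m / real n) t = 1 - real m / real n" if "m \<le> n" for m
        using mem[OF that] unfolding satisfies_Var_iff[OF t] by blast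
      then show ?thesis
        using val h by simp
    next
      assume "Sn n \<Turnstile> t \<approx> tpow (Var 0) n"
      then have "eval (Sn n) (\<lambda>_. 1 - real m / real n) t = 0" if "m \<le> n" "m > 0" for m
        using mem[OF that(1)] n that unfolding Sn_satisfies_power_iff[OF t n] by simp
      then show ?thesis
        using val by (simp add: zero_prod_def)
    qed
    \<comment> \<open>The index \<open>m\<close> is the distance from the top;
      \<open>a = n - m\<close> turns \<open>m > 0\<close> into \<open>a < n\<close>.\<close>
    then have "(\<forall>a. 0 \<le> a \<and> a \<le> int n \<longrightarrow> eval (Sn_omega n) (\<lambda>_. (a, 0)) t = (a, 0)) \<or>
        (\<forall>a. 0 \<le> a \<and> a < int n \<longrightarrow> eval (Sn_omega n) (\<lambda>_. (a, 0)) t = 0)"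
    proof (elim disjE)
      assume *: "\<forall>m\<le>n. eval (Sn_omega n) (\<lambda>_. (int n - int m, 0)) t = (int n - int m, 0)"
      have "eval (Sn_omega n) (\<lambda>_. (a, 0)) t = (a, 0)" if "0 \<le> a" "a \<le> int n" for a
        using *[rule_format, of "nat (int n - a)"] that by simp
      then show ?thesis by blast
    next
      assume *: "\<forall>m\<le>n. m > 0 \<longrightarrow> eval (Sn_omega n) (\<lambda>_. (int n - int m, 0)) t = 0"
      have "eval (Sn_omega n) (\<lambda>_. (a, 0)) t = 0" if "0 \<le> a" "a < int n" for a
        using *[rule_format, of "nat (int n - a)"] that by simp
      then show ?thesis by blast
    qed
    from Sn_omega_conucleus_cases[OF n L rad this] show ?thesis
      by (simp only: satisfies_Var_iff[OF t] Sn_omega_satisfies_radical_iff[OF t n])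
  qed
  show ?L if ?R
    using that
  proof
    assume "Sn_omega n \<Turnstile> t \<approx> Var 0"
    then show ?L
      using multiplicative_conucleus_cong[OF _ conucleus_id] by (simp add: satisfies_Var_iff[OF t])
  next
    assume "Sn_omega n \<Turnstile> t \<approx> radical_term n"
    then show ?L
      using multiplicative_conucleus_cong[OF _ conucleus_Sn_omega_radical[OF n]]
      by (simp only: Sn_omega_satisfies_radical_iff[OF t n])
  qed
qed

section \<open>From the variety to its generators\<close>

text \<open>Forwards, the infinite type \<open>'a\<close> provides a copy of each generator inside
  the variety. Backwards, \<open>conucleus_equations t\<close> is one of the equation sets whose
  classes are intersected.\<close>

lemma conucleus_term_on_variety_iff:
  assumes inf: "infinite (UNIV :: 'a set)" and I: "\<forall>i\<in>I. i > 0"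
  shows "conucleus_term_on (variety_of I J K :: 'a hoop set) t \<longleftrightarrow>
    (\<forall>i\<in>I. conucleus_on (Sn i) t) \<and>
    (if K = {} then \<forall>j\<in>J. conucleus_on (Sn_omega j) t else conucleus_on S_omega t)"
    (is "?L \<longleftrightarrow> ?R")
proof -
  have algebras: "is_algebra (Sn i)" if "i \<in> I" for i
    using I that by (intro interval_hoop.algebra[OF interval_hoop_Sn]) blast
  have R_iff: "?R \<longleftrightarrow> generators_satisfy I J K (conucleus_equations t)"
    using algebras hoop_is_algebra[OF hoop_S_omega] interval_hoop.algebra[OF interval_hoop_Sn_omega]
    by (simp add: generators_satisfy_def satisfies_conucleus_equations_iff)
  show ?thesis
  proof
    assume L: ?L
    have "satisfies_all (Sn i) (conucleus_equations t)" if "i \<in> I" for i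
      by (rule conucleus_generator[OF inf L algebras[OF that] countable_Sn])
        (use that in \<open>simp add: generators_satisfy_def\<close>)
    moreover have "satisfies_all (Sn_omega j) (conucleus_equations t)" if "j \<in> J" "K = {}" for j
      by (rule conucleus_generator[OF inf L interval_hoop.algebra[OF interval_hoop_Sn_omega]
            countable_Sn_omega])
        (use that in \<open>simp add: generators_satisfy_def\<close>)
    moreover have "satisfies_all S_omega (conucleus_equations t)" if "K \<noteq> {}"
      by (rule conucleus_generator[OF inf L hoop_is_algebra[OF hoop_S_omega]])
        (use that in \<open>simp_all add: generators_satisfy_def\<close>)
    ultimately show ?R
      by (simp add: R_iff generators_satisfy_def)
  next
    assume ?R
    then have gen: "generators_satisfy I J K (conucleus_equations t)"
      by (simp only: R_iff)
    show ?L
      unfolding conucleus_term_on_def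
    proof
      fix A :: "'a hoop" assume "A \<in> variety_of I J K"
      then have "A \<in> equational_class (conucleus_equations t)"
        using gen unfolding variety_of_def by blast
      then show "conucleus_on A t"
        using satisfies_conucleus_equations_iff unfolding equational_class_def by blast
    qed
  qed
qed

section \<open>Compatibility of the choices on different generators\<close>

text \<open>Were \<open>d = gcd k l\<close> larger than 1, the coatom \<open>c\<close> of the common
  subalgebra \<open>Sn d\<close> would be both fixed and sent to \<open>0\<close>, although
  \<open>c = 1 - 1/d\<close> is not \<open>0\<close>.\<close>

lemma coprime_of_Sn_identities:
  fixes t :: "nat hterm"
  assumes t: "vars t \<subseteq> {0}" and kl: "k > 0" "l > 0"
    and id: "Sn k \<Turnstile> t \<approx> Var 0" and pow: "Sn l \<Turnstile> t \<approx> tpow (Var 0) l"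
  shows "gcd k l = 1"
proof (rule ccontr)
  define d where "d = gcd k l"
  assume "gcd k l \<noteq> 1"
  moreover have "gcd k l \<noteq> 0"
    using kl by simp
  ultimately have d: "d > 1"
    unfolding d_def by linarith
  define c where "c = 1 - real 1 / real d"
  have c: "c \<in> carrier (Sn d)" "c \<noteq> 1" "c \<noteq> 0"
    using d Sn_carrier_iff[of d c] by (auto simp: c_def intro!: exI[of _ 1])
  interpret k: hoop_embedding "Sn d" "Sn k" "\<lambda>x. x"
    using d kl by (intro hoop_embedding_Sn_Sn) (auto simp: d_def)
  interpret l: hoop_embedding "Sn d" "Sn l" "\<lambda>x. x"
    using d kl by (intro hoop_embedding_Sn_Sn) (auto simp: d_def)
  have "c = eval (Sn k) (\<lambda>_. c) t"
    using id k.closed[OF c(1)] by (simp add: satisfies_Var_iff[OF t])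
  also have "\<dots> = eval (Sn l) (\<lambda>_. c) t"
    using k.hom_eval[of "\<lambda>_. c" t] l.hom_eval[of "\<lambda>_. c" t] c(1) by simp
  also have "\<dots> = 0"
    using pow l.closed[OF c(1)] c(2) by (simp add: Sn_satisfies_power_iff[OF t kl(2)])
  finally show False
    using c(3) by simp
qed

text \<open>Restriction to the skeleton, which meets the radical only in the top. It lets indices
  from \<open>J2\<close> be treated like those from \<open>I2\<close> in the coprimality
  argument.\<close>

lemma Sn_satisfies_power_if_radical:
  assumes t: "vars t \<subseteq> {0}" and n: "n > 0" and rad: "Sn_omega n \<Turnstile> t \<approx> radical_term n"
  shows "Sn n \<Turnstile> t \<approx> tpow (Var 0) n"
proof -
  have "Sn n \<Turnstile> t \<approx> radical_term n"
    by (rule hoop_embedding.satisfies_eq_reflect[OF hoop_embedding_Sn_Sn_omega[OF n] rad])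
  moreover have "eval (Sn n) (\<lambda>_. a) (radical_term n) = (if a = 1 then 1 else 0)"
    if a: "a \<in> carrier (Sn n)" for a
  proof -
    have pow: "eval (Sn n) (\<lambda>_. a) (tpow (Var 0) (n + 1)) = (if a = 1 then 1 else 0)"
      "eval (Sn n) (\<lambda>_. a) (tpow (Var 0) (2 * (n + 1))) = (if a = 1 then 1 else 0)"
      by (rule eval_tpow_Sn_eq[OF n _ a]; simp)+
    show ?thesis
      using interval_hoop.bounds[OF interval_hoop_Sn[OF n] a]
      unfolding eval.simps pow by (simp add: Sn_sel)
  qed
  ultimately show ?thesis
    unfolding satisfies_unary_iff[OF t vars_radical_term] Sn_satisfies_power_iff[OF t n] by metis
qed

text \<open>The atom \<open>(0, 1)\<close> of the common subalgebra \<open>Sn_omega 1\<close> would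
  be fixed on one side and sent to \<open>0\<close> on the other.\<close>

lemma Sn_omega_not_id_and_radical:
  assumes t: "vars t \<subseteq> {0}" and ij: "i > 0" "j > 0"
    and id: "Sn_omega i \<Turnstile> t \<approx> Var 0" and rad: "Sn_omega j \<Turnstile> t \<approx> radical_term j"
  shows False
proof -
  interpret i: hoop_embedding "Sn_omega 1" "Sn_omega i" "map_prod ((*) (int i)) (\<lambda>b. b)"
    by (rule hoop_embedding_Sn_omega_1[OF ij(1)])
  interpret j: hoop_embedding "Sn_omega 1" "Sn_omega j" "map_prod ((*) (int j)) (\<lambda>b. b)"
    by (rule hoop_embedding_Sn_omega_1[OF ij(2)])
  have mem: "(0, 1) \<in> carrier (Sn_omega 1)"
    by (simp add: Sn_omega_carrier_iff)
  have "eval (Sn_omega 1) (\<lambda>_. (0, 1)) t = (0, 1)"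
    using i.satisfies_eq_reflect[OF id] mem by (simp only: satisfies_Var_iff[OF t])
  then have "eval (Sn_omega j) (\<lambda>_. (0, 1)) t = (0, 1)"
    using j.hom_eval[of "\<lambda>_. (0, 1)" t] mem by simp
  moreover have "eval (Sn_omega j) (\<lambda>_. (0, 1)) t = (0, 0)"
    using bspec[OF iffD1[OF Sn_omega_satisfies_radical_iff[OF t ij(2)] rad] j.closed[OF mem]] ij(2)
    by (simp add: zero_prod_def)
  ultimately show False
    by simp
qed

theorem theorem5p6:
  fixes I J K :: "nat set" and t x :: "nat hterm"
  assumes "reduced_triple I J K"
    and "vars t \<subseteq> {0}"
    and "x = Var 0"
    and "infinite (UNIV :: 'a set)"
  shows "conucleus_term_on (variety_of I J K :: 'a hoop set) t \<longleftrightarrow>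
    (\<exists>I1 I2 J1 J2. I1 \<subseteq> I \<and> I2 \<subseteq> I \<and> J1 \<subseteq> J \<and> J2 \<subseteq> J \<and>
       I1 \<union> I2 = I \<and> I1 \<inter> I2 = {} \<and>
       (J1, J2) \<in> {(J, {}), ({}, J)} \<and>
       (\<forall>k \<in> I1 \<union> J1. \<forall>l \<in> I2 \<union> J2. gcd k l = 1) \<and>
       (\<forall>i\<in>I1. Sn i \<Turnstile> t \<approx> x) \<and>
       (\<forall>j\<in>J1. Sn_omega j \<Turnstile> t \<approx> x) \<and>
       (\<forall>i\<in>I2. Sn i \<Turnstile> t \<approx> tpow x i) \<and>
       (\<forall>j\<in>J2. Sn_omega j \<Turnstile>
          t \<approx> x \<odot> ((tpow x (j + 1) \<rightarrow>\<^sub>t tpow x (2 * (j + 1))) \<rightarrow>\<^sub>t tpow x (j + 1))) \<and>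
       (K = {0} \<longrightarrow> S_omega \<Turnstile> t \<approx> x))"
    (is "?L \<longleftrightarrow> ?R")
proof -
  note t = assms(2) and x = assms(3)
  have pos: "i > 0" if "i \<in> I \<union> J" for i
    using assms(1) that by (auto simp: reduced_triple_def)
  have K: "K = {} \<or> K = {0} \<and> J = {}"
    using assms(1) by (auto simp: reduced_triple_def)
  have "?L \<longleftrightarrow> (\<forall>i\<in>I. conucleus_on (Sn i) t) \<and>
      (if K = {} then \<forall>j\<in>J. conucleus_on (Sn_omega j) t else conucleus_on S_omega t)"
    using pos by (intro conucleus_term_on_variety_iff[OF assms(4)]) blast
  also have "\<dots> \<longleftrightarrow> (\<forall>i\<in>I. Sn i \<Turnstile> t \<approx> x \<or> Sn i \<Turnstile> t \<approx> tpow x i) \<and>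
      (\<forall>j\<in>J. Sn_omega j \<Turnstile> t \<approx> x \<or> Sn_omega j \<Turnstile> t \<approx> radical_term j) \<and>
      (K = {0} \<longrightarrow> S_omega \<Turnstile> t \<approx> x)" (is "_ \<longleftrightarrow> ?G")
  proof -
    have "(\<forall>i\<in>I. conucleus_on (Sn i) t) \<longleftrightarrow> (\<forall>i\<in>I. Sn i \<Turnstile> t \<approx> x \<or> Sn i \<Turnstile> t \<approx> tpow x i)"
      unfolding x by (intro ball_cong refl Sn_conucleus_iff[OF t] pos) simp
    moreover have "(\<forall>j\<in>J. conucleus_on (Sn_omega j) t) \<longleftrightarrow>
        (\<forall>j\<in>J. Sn_omega j \<Turnstile> t \<approx> x \<or> Sn_omega j \<Turnstile> t \<approx> radical_term j)"
      unfolding x by (intro ball_cong refl Sn_omega_conucleus_iff[OF t] pos) simp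
    moreover have "conucleus_on S_omega t \<longleftrightarrow> S_omega \<Turnstile> t \<approx> x"
      unfolding x by (rule S_omega_conucleus_iff[OF t])
    \<comment> \<open>If \<open>K = {0}\<close> then \<open>J = {}\<close>, so the clause of
      \<open>?G\<close> for \<open>J\<close> is vacuous there.\<close>
    ultimately show ?thesis
      using K by auto
  qed
  also have "\<dots> \<longleftrightarrow> ?R"
  proof
    assume G: ?G
    \<comment> \<open>Every index where \<open>t\<close> is the identity goes into
      \<open>I1\<close>. This settles \<open>i = 1\<close>, where \<open>x\<close> and
      \<open>x^i\<close> agree. \<open>J1\<close> is all of \<open>J\<close> or empty by
      construction.\<close>
    define I1 where "I1 = {i \<in> I. Sn i \<Turnstile> t \<approx> x}"
    define I2 where "I2 = I - I1"
    define J1 where "J1 = (if \<forall>j\<in>J. Sn_omega j \<Turnstile> t \<approx> x then J else {})"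
    define J2 where "J2 = J - J1"
    have I2: "Sn i \<Turnstile> t \<approx> tpow x i" if "i \<in> I2" for i
      using G that by (auto simp: I1_def I2_def)
    have J1: "Sn_omega j \<Turnstile> t \<approx> x" if "j \<in> J1" for j
      using that by (simp add: J1_def split: if_splits)
    have J2: "Sn_omega j \<Turnstile> t \<approx> radical_term j" if "j \<in> J2" for j
    proof -
      from that have j: "j \<in> J"
        by (simp add: J2_def)
      \<comment> \<open>\<open>J2\<close> is inhabited only if the identity fails at some
        \<open>i\<close> in \<open>J\<close>. The radical equation then holds at \<open>i\<close>,
        which excludes the identity at every \<open>j\<close> in \<open>J\<close>.\<close>
      from that obtain i where i: "i \<in> J" "\<not> Sn_omega i \<Turnstile> t \<approx> x"
        by (auto simp: J1_def J2_def split: if_splits)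
      then have "Sn_omega i \<Turnstile> t \<approx> radical_term i"
        using G by blast
      then have "\<not> Sn_omega j \<Turnstile> t \<approx> x"
        using Sn_omega_not_id_and_radical[OF t pos pos] i(1) j unfolding x by blast
      then show ?thesis
        using G j by blast
    qed
    \<comment> \<open>Indices from \<open>J1\<close> and \<open>J2\<close> are replaced by their
      skeletons, so that the gcd condition only concerns finite chains.\<close>
    have id: "Sn k \<Turnstile> t \<approx> Var 0" "k > 0" if "k \<in> I1 \<union> J1" for k
    proof -
      show "k > 0"
        using that pos by (auto simp: I1_def J1_def split: if_splits)
      show "Sn k \<Turnstile> t \<approx> Var 0"
        using that
      proof
        assume "k \<in> J1"
        then show ?thesis
          using hoop_embedding.satisfies_eq_reflect[OF hoop_embedding_Sn_Sn_omega[OF \<open>k > 0\<close>]] J1 x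
          by blast
      qed (simp add: I1_def x)
    qed
    have pow: "Sn l \<Turnstile> t \<approx> tpow (Var 0) l" "l > 0" if "l \<in> I2 \<union> J2" for l
    proof -
      show "l > 0"
        using that pos by (auto simp: I2_def J2_def)
      show "Sn l \<Turnstile> t \<approx> tpow (Var 0) l"
        using that
      proof
        assume "l \<in> J2"
        then show ?thesis
          using Sn_satisfies_power_if_radical[OF t \<open>l > 0\<close>] J2 by blast
      qed (use I2 x in blast)
    qed
    have gcd: "\<forall>k \<in> I1 \<union> J1. \<forall>l \<in> I2 \<union> J2. gcd k l = 1"
      by (intro ballI coprime_of_Sn_identities[OF t] id pow)
    show ?R
    proof (intro exI conjI)
      show "I1 \<subseteq> I" "I2 \<subseteq> I" "J1 \<subseteq> J" "J2 \<subseteq> J" "I1 \<union> I2 = I" "I1 \<inter> I2 = {}"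
        by (auto simp: I1_def I2_def J1_def J2_def split: if_splits)
      show "(J1, J2) \<in> {(J, {}), ({}, J)}"
        by (simp add: J1_def J2_def)
      show "\<forall>i\<in>I1. Sn i \<Turnstile> t \<approx> x"
        by (simp add: I1_def)
      show "K = {0} \<longrightarrow> S_omega \<Turnstile> t \<approx> x"
        using G by (elim conjE)
      show "\<forall>k \<in> I1 \<union> J1. \<forall>l \<in> I2 \<union> J2. gcd k l = 1"
        by (rule gcd)
      show "\<forall>j\<in>J1. Sn_omega j \<Turnstile> t \<approx> x"
        by (rule ballI) (rule J1)
      show "\<forall>i\<in>I2. Sn i \<Turnstile> t \<approx> tpow x i"
        by (rule ballI) (rule I2)
      show "\<forall>j\<in>J2. Sn_omega j \<Turnstile>
          t \<approx> x \<odot> ((tpow x (j + 1) \<rightarrow>\<^sub>t tpow x (2 * (j + 1))) \<rightarrow>\<^sub>t tpow x (j + 1))"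
        unfolding x by (rule ballI) (rule J2)
    qed
  next
    assume ?R
    from this[unfolded x] obtain I1 I2 J1 J2
      where sets: "I1 \<union> I2 = I" "(J1, J2) \<in> {(J, {}), ({}, J)}"
      and sat: "\<forall>i\<in>I1. Sn i \<Turnstile> t \<approx> Var 0" "\<forall>j\<in>J1. Sn_omega j \<Turnstile> t \<approx> Var 0"
        "\<forall>i\<in>I2. Sn i \<Turnstile> t \<approx> tpow (Var 0) i" "\<forall>j\<in>J2. Sn_omega j \<Turnstile> t \<approx> radical_term j"
        "K = {0} \<longrightarrow> S_omega \<Turnstile> t \<approx> Var 0"
      by (elim exE conjE) (rule that)
    have "J \<subseteq> J1 \<union> J2"
      using sets(2) by auto
    then show ?G
      using sets(1) sat unfolding x by (intro conjI ballI) blast+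
  qed
  finally show ?thesis .
qed

end
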